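(* For every integer $n>1$: if $p\in[2,\infty)$ then $$H_p^n=\Big(\frac{2^p-1}{2^{p+1}-1}\Big)^{1/p};$$ and if $p\in(0,2)$ there exist constants $C,D>0$ (depending only on $p$) such that for all $n>1$, $$C\Big(\frac{\log n}{n}\Big)^{\frac{2-p}{2p}}\le H_p^n\le D\Big(\frac{\log n}{n}\Big)^{\frac{2-p}{2p}}.$$
   Context: For $p>0$ and a holomorphic $f:\mathbb D^n\to\mathbb C$ ($\mathbb D^n$ the open unit polydisk), $f(z)=x_0+\sum_{|\alpha|\ge1}x_\alpha z^\alpha$ (multi-index notation) with $\operatorname{Re}f(z)>0$ on $\mathbb D^n$ and $f(0)=1$, let $H_p^n(f)=\sup\{r\ge0:\frac12(|x_0|^p+\sum_{k\ge1}\sum_{|\alpha|=k}|x_\alpha z^\alpha|^p)^{1/p}\le1\ \forall z\in r\mathbb D^n\}$, and $H_p^n=\inf$ of $H_p^n(f)$ over all such $f$. *)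

theory Defs
  imports "HOL-Analysis.Analysis"
begin

definition multi_idx :: "nat \<Rightarrow> (nat \<Rightarrow> nat) set" where
  "multi_idx n = {\<alpha>. \<forall>i\<ge>n. \<alpha> i = 0}"

definition monom :: "nat \<Rightarrow> (nat \<Rightarrow> complex) \<Rightarrow> (nat \<Rightarrow> nat) \<Rightarrow> complex" where
  "monom n z \<alpha> = (\<Prod>i<n. z i ^ \<alpha> i)"

definition polydisk :: "nat \<Rightarrow> real \<Rightarrow> (nat \<Rightarrow> complex) set" where
  "polydisk n r = {z. \<forall>i<n. norm (z i) < r}"

definition pser :: "nat \<Rightarrow> ((nat \<Rightarrow> nat) \<Rightarrow> complex) \<Rightarrow> (nat \<Rightarrow> complex) \<Rightarrow> complex" where
  "pser n x z = (\<Sum>\<^sub>\<infinity>\<alpha>\<in>multi_idx n. x \<alpha> * monom n z \<alpha>)"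

text \<open>x is the coefficient family of a holomorphic f on D^n (its power series converges on D^n)
  with Re f > 0 on D^n and f(0) = 1.\<close>
definition carath_class :: "nat \<Rightarrow> ((nat \<Rightarrow> nat) \<Rightarrow> complex) \<Rightarrow> bool" where
  "carath_class n x \<longleftrightarrow>
     (\<forall>z\<in>polydisk n 1. (\<lambda>\<alpha>. x \<alpha> * monom n z \<alpha>) summable_on multi_idx n \<and> Re (pser n x z) > 0)
     \<and> x (\<lambda>_. 0) = 1"

definition boh_ineq :: "real \<Rightarrow> nat \<Rightarrow> ((nat \<Rightarrow> nat) \<Rightarrow> complex) \<Rightarrow> (nat \<Rightarrow> complex) \<Rightarrow> bool" where
  "boh_ineq p n x z \<longleftrightarrow>
     (\<lambda>\<alpha>. norm (x \<alpha> * monom n z \<alpha>) powr p) summable_on (multi_idx n - {\<lambda>_. 0}) \<and>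
     (norm (x (\<lambda>_. 0)) powr p
        + (\<Sum>\<^sub>\<infinity>\<alpha>\<in>multi_idx n - {\<lambda>_. 0}. norm (x \<alpha> * monom n z \<alpha>) powr p)) powr (1 / p) / 2 \<le> 1"

text \<open>H_p^n(f), as an extended real (it may be +infinity, e.g. for f = 1).\<close>
definition Hf :: "real \<Rightarrow> nat \<Rightarrow> ((nat \<Rightarrow> nat) \<Rightarrow> complex) \<Rightarrow> ereal" where
  "Hf p n x = Sup (ereal ` {r. r \<ge> 0 \<and> (\<forall>z\<in>polydisk n r. boh_ineq p n x z)})"

definition H :: "real \<Rightarrow> nat \<Rightarrow> ereal" where
  "H p n = Inf (Hf p n ` {x. carath_class n x})"

end

theory Submission
  imports Defs "HOL-Complex_Analysis.Cauchy_Integral_Formula"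
begin

text \<open>
  By Caratheodory's inequality on complex lines through the origin, each homogeneous part \<open>P\<^sub>m\<close> of
  \<open>f\<close> is bounded by 2 on the polytorus. For \<open>p \<ge> 2\<close>, Parseval bounds the \<open>\<ell>\<^sup>2\<close>-norm, hence the
  \<open>\<ell>\<^sup>p\<close>-norm, of its coefficients by 2, and \<open>(1 + z\<^sub>0) / (1 - z\<^sub>0)\<close> is extremal.

  For \<open>p < 2\<close> the lower bound comes from the radial derivatives \<open>R\<^sub>i = z\<^sub>i \<partial>P\<^sub>m/\<partial>z\<^sub>i\<close>. Cauchy's inequality
  gives \<open>\<Sum>\<^sub>i |R\<^sub>i| \<le> 6m\<close> on the torus, and \<open>m\<close>-homogeneous polynomials satisfy
  \<open>\<parallel>R\<parallel>\<^sub>2 \<le> 4 \<cdot> 2\<^sup>m \<parallel>R\<parallel>\<^sub>1\<close>, because a multi-index of degree \<open>2m\<close> has at most \<open>4\<^sup>m\<close> splittings into two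
  multi-indices. So the \<open>\<ell>\<^sup>2\<close>-norms of the coefficients of the \<open>R\<^sub>i\<close> sum to at most \<open>24 \<cdot> 4\<^sup>m\<close>, and
  the power mean inequality over the at most \<open>e\<^sup>m ((n+m)/m)\<^bsup>m-1\<^esup>\<close> monomials of each \<open>R\<^sub>i\<close> bounds the
  \<open>p\<close>-th power sum of the coefficients of \<open>P\<^sub>m\<close> by \<open>B\<^sup>m (n / ln n)\<^bsup>m(1 - p/2)\<^esup>\<close>.

  For the upper bound, products of discrete Fourier matrices give an \<open>m\<close>-linear form with \<open>q\<^sup>m\<close>
  unimodular coefficients and sup norm at most \<open>q\<^bsup>(m+1)/2\<^esup>\<close>, used with \<open>m\<close> close to \<open>ln n\<close>
  and \<open>q\<close> close to \<open>n/m\<close>. All torus averages are finite averages over roots of unity.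
\<close>

section \<open>Finite Fourier analysis on grids of roots of unity\<close>

text \<open>The bounds may vary with the coordinate: constant bounds give the exponents and sample
  points of a grid, the bounds \<open>Suc (\<gamma> i)\<close> give the divisors of the monomial
  with exponent \<open>\<gamma>\<close>.\<close>

definition idx_box :: "nat \<Rightarrow> (nat \<Rightarrow> nat) \<Rightarrow> (nat \<Rightarrow> nat) set" where
  "idx_box n M = {\<alpha> \<in> multi_idx n. \<forall>i<n. \<alpha> i < M i}"

lemma idx_box_0: "idx_box 0 M = {\<lambda>_. 0}"
  by (auto simp: idx_box_def multi_idx_def)

lemma idx_box_Suc:
  "idx_box (Suc n) M = (\<lambda>(\<alpha>, j). \<alpha>(n := j)) ` (idx_box n M \<times> {..<M n})"
proof (intro equalityI subsetI)
  fix \<alpha> assume "\<alpha> \<in> idx_box (Suc n) M"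
  then have "\<alpha> = (\<alpha>(n := 0))(n := \<alpha> n)" "\<alpha>(n := 0) \<in> idx_box n M" "\<alpha> n < M n"
    by (auto simp: idx_box_def multi_idx_def fun_eq_iff le_Suc_eq)
  then show "\<alpha> \<in> (\<lambda>(\<alpha>, j). \<alpha>(n := j)) ` (idx_box n M \<times> {..<M n})"
    by (intro image_eqI[of _ _ "(\<alpha>(n := 0), \<alpha> n)"]) auto
qed (auto simp: idx_box_def multi_idx_def less_Suc_eq)

lemma inj_on_idx_box_upd: "inj_on (\<lambda>(\<alpha>, j). \<alpha>(n := j)) (idx_box n M \<times> J)"
proof (rule inj_onI, clarify)
  fix \<alpha> \<beta> :: "nat \<Rightarrow> nat" and i j
  assume "\<alpha> \<in> idx_box n M" "\<beta> \<in> idx_box n M" and eq: "\<alpha>(n := i) = \<beta>(n := j)"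
  then have "\<alpha> n = \<beta> n" by (simp add: idx_box_def multi_idx_def)
  with eq show "\<alpha> = \<beta> \<and> i = j" by (metis fun_upd_eqD fun_upd_triv fun_upd_upd)
qed

lemma finite_idx_box [simp]: "finite (idx_box n M)"
  by (induction n) (auto simp: idx_box_0 idx_box_Suc)

lemma sum_idx_box_Suc:
  "(\<Sum>\<alpha>\<in>idx_box (Suc n) M. g \<alpha>) = (\<Sum>\<alpha>\<in>idx_box n M. \<Sum>j<M n. g (\<alpha>(n := j)))"
  unfolding idx_box_Suc
  by (subst sum.reindex[OF inj_on_idx_box_upd]) (simp add: sum.cartesian_product case_prod_beta)

lemma sum_idx_box_prod:
  fixes f :: "nat \<Rightarrow> nat \<Rightarrow> 'a :: comm_semiring_1"
  shows "(\<Sum>\<alpha>\<in>idx_box n M. \<Prod>i<n. f i (\<alpha> i)) = (\<Prod>i<n. \<Sum>j<M i. f i j)"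
proof (induction n)
  case (Suc n)
  have "(\<Sum>\<alpha>\<in>idx_box (Suc n) M. \<Prod>i<Suc n. f i (\<alpha> i))
      = (\<Sum>\<alpha>\<in>idx_box n M. \<Sum>j<M n. (\<Prod>i<n. f i (\<alpha> i)) * f n j)"
    by (simp add: sum_idx_box_Suc)
  also have "\<dots> = (\<Prod>i<Suc n. \<Sum>j<M i. f i j)"
    by (simp add: sum_distrib_left[symmetric] sum_distrib_right[symmetric] Suc)
  finally show ?case .
qed (simp add: idx_box_0)

lemma card_idx_box: "card (idx_box n M) = (\<Prod>i<n. M i)"
  using sum_idx_box_prod[of "\<lambda>_ _. 1 :: nat" n M] by simp

section \<open>Roots of unity and orthogonality of monomials on a grid\<close>

definition root_unity :: "nat \<Rightarrow> int \<Rightarrow> complex" where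
  "root_unity M k = cis (2 * pi * of_int k / real M)"

lemma root_unity_add: "root_unity M (a + b) = root_unity M a * root_unity M b"
  by (simp add: root_unity_def cis_mult field_simps add_divide_distrib)

lemma root_unity_power: "root_unity M a ^ k = root_unity M (a * int k)"
  unfolding root_unity_def Complex.DeMoivre by (simp add: mult_ac)

lemma cnj_root_unity: "cnj (root_unity M a) = root_unity M (- a)"
  by (simp add: root_unity_def cis_cnj)

lemma norm_root_unity [simp]: "norm (root_unity M a) = 1"
  by (simp add: root_unity_def)

lemma root_unity_0 [simp]: "root_unity M 0 = 1"
  by (simp add: root_unity_def)

lemma root_unity_eq_1_iff:
  assumes "M > 0"
  shows "root_unity M k = 1 \<longleftrightarrow> int M dvd k"
proof
  assume "root_unity M k = 1"
  then have "cos (2 * pi * of_int k / real M) = 1"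
    by (simp add: root_unity_def complex_eq_iff)
  then obtain j :: int where "2 * pi * of_int k / real M = of_int j * 2 * pi"
    by (auto simp: cos_one_2pi_int)
  then have "real_of_int k = of_int (j * int M)"
    using assms by (simp add: field_simps)
  then have "k = j * int M" by linarith
  then show "int M dvd k" by simp
next
  assume "int M dvd k"
  then obtain j where "k = int M * j" by auto
  then have "2 * pi * of_int k / real M = 2 * pi * of_int j"
    using assms by simp
  then show "root_unity M k = 1"
    unfolding root_unity_def by (simp only: cis_multiple_2pi Ints_of_int)
qed

lemma sum_root_unity:
  assumes "M > 0"
  shows "(\<Sum>b<M. root_unity M (int b * k)) = (if int M dvd k then of_nat M else 0)"
proof (cases "int M dvd k")
  case True
  then have "root_unity M (int b * k) = 1" for b
    using assms by (simp add: root_unity_eq_1_iff)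
  then show ?thesis using True by simp
next
  case False
  have "(\<Sum>b<M. root_unity M (int b * k)) = (\<Sum>b<M. root_unity M k ^ b)"
    by (simp add: root_unity_power mult_ac)
  also have "\<dots> = (root_unity M k ^ M - 1) / (root_unity M k - 1)"
    using False assms by (intro geometric_sum) (simp add: root_unity_eq_1_iff)
  also have "root_unity M k ^ M = 1"
    using assms by (simp add: root_unity_power root_unity_eq_1_iff)
  finally show ?thesis using False by simp
qed

definition grid_pt :: "nat \<Rightarrow> (nat \<Rightarrow> nat) \<Rightarrow> nat \<Rightarrow> complex" where
  "grid_pt M \<beta> i = root_unity M (int (\<beta> i))"

lemma norm_grid_pt [simp]: "norm (grid_pt M \<beta> i) = 1"
  by (simp add: grid_pt_def)

abbreviation grid :: "nat \<Rightarrow> nat \<Rightarrow> (nat \<Rightarrow> nat) set" where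
  "grid n M \<equiv> idx_box n (\<lambda>_. M)"

lemma card_grid [simp]: "card (grid n M) = M ^ n"
  by (simp add: card_idx_box)

text \<open>The sum factors over the coordinates, and each exponent difference has absolute value
  below \<open>M\<close>, so \<open>M\<close> divides it only if it is zero.\<close>

lemma grid_orthogonality:
  assumes "\<alpha> \<in> grid n M" "\<alpha>' \<in> grid n M" "M > 0"
  shows "(\<Sum>\<beta>\<in>grid n M. Defs.monom n (grid_pt M \<beta>) \<alpha> * cnj (Defs.monom n (grid_pt M \<beta>) \<alpha>'))
       = (if \<alpha> = \<alpha>' then of_nat M ^ n else 0)"
proof -
  let ?k = "\<lambda>i. int (\<alpha> i) - int (\<alpha>' i)"
  have "(\<Sum>\<beta>\<in>grid n M. Defs.monom n (grid_pt M \<beta>) \<alpha> * cnj (Defs.monom n (grid_pt M \<beta>) \<alpha>'))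
     = (\<Sum>\<beta>\<in>grid n M. \<Prod>i<n. root_unity M (int (\<beta> i) * ?k i))"
    by (simp add: Defs.monom_def grid_pt_def root_unity_power cnj_root_unity
        prod.distrib[symmetric] root_unity_add[symmetric] right_diff_distrib)
  also have "\<dots> = (\<Prod>i<n. if int M dvd ?k i then of_nat M else 0)"
    by (simp add: sum_idx_box_prod[of "\<lambda>i b. root_unity M (int b * ?k i)"] sum_root_unity assms)
  also have "\<dots> = (\<Prod>i<n. if \<alpha> i = \<alpha>' i then of_nat M else 0)"
  proof (rule prod.cong)
    fix i assume "i \<in> {..<n}"
    then have "\<alpha> i < M" "\<alpha>' i < M" using assms by (auto simp: idx_box_def)
    then have "int M dvd ?k i \<longleftrightarrow> \<alpha> i = \<alpha>' i"
      using zdvd_imp_le[of "int M" "\<bar>?k i\<bar>"] by fastforce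
    then show "(if int M dvd ?k i then of_nat M else 0)
             = (if \<alpha> i = \<alpha>' i then of_nat M else 0 :: complex)" by simp
  qed simp
  also have "\<dots> = (if \<alpha> = \<alpha>' then of_nat M ^ n else 0)"
  proof (cases "\<alpha> = \<alpha>'")
    case False
    then obtain i where "\<alpha> i \<noteq> \<alpha>' i" by auto
    moreover from this have "i < n"
      using assms by (metis (mono_tags, lifting) idx_box_def mem_Collect_eq multi_idx_def not_le)
    ultimately show ?thesis using False by (auto intro!: prod_zero)
  qed simp
  finally show ?thesis .
qed

text \<open>Grid averages replace torus integrals without error, since distinct exponents in
  \<open>A\<close> are never congruent modulo \<open>M\<close>.\<close>

lemma grid_parseval:
  assumes "A \<subseteq> grid n M" "M > 0"
  shows "(\<Sum>\<beta>\<in>grid n M. (norm (\<Sum>\<alpha>\<in>A. c \<alpha> * Defs.monom n (grid_pt M \<beta>) \<alpha>))\<^sup>2)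
       = real M ^ n * (\<Sum>\<alpha>\<in>A. (norm (c \<alpha>))\<^sup>2)"
proof -
  let ?e = "\<lambda>\<beta>. Defs.monom n (grid_pt M \<beta>)"
  have fin: "finite A" using assms finite_subset finite_idx_box by blast
  have "complex_of_real (\<Sum>\<beta>\<in>grid n M. (norm (\<Sum>\<alpha>\<in>A. c \<alpha> * ?e \<beta> \<alpha>))\<^sup>2)
      = (\<Sum>\<beta>\<in>grid n M. \<Sum>\<alpha>\<in>A. \<Sum>\<alpha>'\<in>A. c \<alpha> * cnj (c \<alpha>') * (?e \<beta> \<alpha> * cnj (?e \<beta> \<alpha>')))"
    by (simp add: complex_norm_square sum_product mult_ac del: of_real_power)
  also have "\<dots> = (\<Sum>\<alpha>\<in>A. \<Sum>\<alpha>'\<in>A. \<Sum>\<beta>\<in>grid n M. c \<alpha> * cnj (c \<alpha>') * (?e \<beta> \<alpha> * cnj (?e \<beta> \<alpha>')))"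
    by (subst sum.swap, rule sum.cong[OF refl], subst sum.swap, rule refl)
  also have "\<dots> = (\<Sum>\<alpha>\<in>A. \<Sum>\<alpha>'\<in>A. if \<alpha> = \<alpha>' then c \<alpha> * cnj (c \<alpha>') * of_nat M ^ n else 0)"
  proof (intro sum.cong refl)
    fix \<alpha> \<alpha>' assume "\<alpha> \<in> A" "\<alpha>' \<in> A"
    then have "\<alpha> \<in> grid n M" "\<alpha>' \<in> grid n M" using assms by auto
    then show "(\<Sum>\<beta>\<in>grid n M. c \<alpha> * cnj (c \<alpha>') * (?e \<beta> \<alpha> * cnj (?e \<beta> \<alpha>')))
         = (if \<alpha> = \<alpha>' then c \<alpha> * cnj (c \<alpha>') * of_nat M ^ n else 0)"
      using grid_orthogonality[of \<alpha> n M \<alpha>'] assms(2) by (auto simp: sum_distrib_left[symmetric])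
  qed
  also have "\<dots> = complex_of_real (real M ^ n * (\<Sum>\<alpha>\<in>A. (norm (c \<alpha>))\<^sup>2))"
    using fin by (simp add: complex_norm_square[symmetric] sum_distrib_left mult.commute[of "of_nat M ^ n"])
  finally show ?thesis by (simp only: of_real_eq_iff)
qed

section \<open>Moments of homogeneous polynomials\<close>

definition hom_idx :: "nat \<Rightarrow> nat \<Rightarrow> (nat \<Rightarrow> nat) set" where
  "hom_idx n m = {\<alpha> \<in> multi_idx n. (\<Sum>i<n. \<alpha> i) = m}"

definition hom_part :: "nat \<Rightarrow> nat \<Rightarrow> ((nat \<Rightarrow> nat) \<Rightarrow> complex) \<Rightarrow> (nat \<Rightarrow> complex) \<Rightarrow> complex" where
  "hom_part n m c z = (\<Sum>\<alpha>\<in>hom_idx n m. c \<alpha> * Defs.monom n z \<alpha>)"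

lemma hom_idx_le: "\<alpha> \<in> hom_idx n m \<Longrightarrow> \<alpha> i \<le> m"
  using member_le_sum[of i "{..<n}" \<alpha>]
  by (cases "i < n") (auto simp: hom_idx_def multi_idx_def)

lemma hom_idx_subset_grid: "m < M \<Longrightarrow> hom_idx n m \<subseteq> grid n M"
  unfolding idx_box_def using hom_idx_le[of _ n m] by (auto simp: hom_idx_def intro: le_less_trans)

lemma finite_hom_idx [simp]: "finite (hom_idx n m)"
  using hom_idx_subset_grid[of m "Suc m" n] finite_subset finite_idx_box by blast

lemma hom_idx_0: "hom_idx n 0 = {\<lambda>_. 0}"
  by (auto simp: hom_idx_def multi_idx_def fun_eq_iff) (meson lessThan_iff not_le)

lemma monom_add: "Defs.monom n z (\<lambda>i. \<alpha> i + \<beta> i) = Defs.monom n z \<alpha> * Defs.monom n z \<beta>"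
  by (simp add: Defs.monom_def power_add prod.distrib)

lemma hom_idx_add:
  "\<alpha> \<in> hom_idx n k \<Longrightarrow> \<beta> \<in> hom_idx n m \<Longrightarrow> (\<lambda>i. \<alpha> i + \<beta> i) \<in> hom_idx n (k + m)"
  by (simp add: hom_idx_def multi_idx_def sum.distrib)

text \<open>\<open>\<alpha>\<close> determines \<open>\<beta>\<close> and is bounded by
  \<open>\<gamma>\<close> in each coordinate; the number of such \<open>\<alpha>\<close> is a
  product of factors \<open>Suc (\<gamma> i) \<le> 2 ^ \<gamma> i\<close>.\<close>

lemma card_splittings_le:
  assumes "\<gamma> \<in> hom_idx n k"
  shows "card {(\<alpha>, \<beta>). \<alpha> \<in> multi_idx n \<and> \<beta> \<in> multi_idx n \<and> (\<lambda>i. \<alpha> i + \<beta> i) = \<gamma>} \<le> 2 ^ k"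
proof -
  let ?S = "{(\<alpha>, \<beta>). \<alpha> \<in> multi_idx n \<and> \<beta> \<in> multi_idx n \<and> (\<lambda>i. \<alpha> i + \<beta> i) = \<gamma>}"
  have "card ?S \<le> card (idx_box n (\<lambda>i. Suc (\<gamma> i)))"
  proof (rule card_inj_on_le[of fst])
    show "inj_on fst ?S" by (auto simp: inj_on_def fun_eq_iff) (metis add_left_cancel)
    show "fst ` ?S \<subseteq> idx_box n (\<lambda>i. Suc (\<gamma> i))" by (auto simp: idx_box_def)
  qed simp
  also have "\<dots> = (\<Prod>i<n. Suc (\<gamma> i))" by (rule card_idx_box)
  also have "\<dots> \<le> (\<Prod>i<n. 2 ^ \<gamma> i)" by (intro prod_mono) (auto simp: Suc_le_eq)
  also have "\<dots> = 2 ^ k" using assms by (simp add: hom_idx_def power_sum[symmetric])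
  finally show ?thesis .
qed

text \<open>\<open>norm P ^ 4\<close> is the squared modulus of \<open>P\<^sup>2\<close>, to which
  Parseval applies since its degree \<open>2 * m\<close> is below \<open>M\<close>. A coefficient
  \<open>e \<gamma>\<close> of the square sums over at most \<open>4 ^ m\<close> splittings of
  \<open>\<gamma>\<close>, and Cauchy-Schwarz turns this count into the constant.\<close>

lemma hom_part_fourth_moment:
  assumes "2 * m < M"
  shows "(\<Sum>\<beta>\<in>grid n M. norm (hom_part n m c (grid_pt M \<beta>)) ^ 4)
       \<le> real M ^ n * (4 ^ m * (\<Sum>\<alpha>\<in>hom_idx n m. (norm (c \<alpha>))\<^sup>2)\<^sup>2)"
proof -
  define B where "B = hom_idx n m \<times> hom_idx n m"
  define s :: "(nat \<Rightarrow> nat) \<times> (nat \<Rightarrow> nat) \<Rightarrow> nat \<Rightarrow> nat" where "s = (\<lambda>p i. fst p i + snd p i)"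
  define e where "e \<gamma> = (\<Sum>p\<in>{p \<in> B. s p = \<gamma>}. c (fst p) * c (snd p))" for \<gamma>
  have fin: "finite B" by (simp add: B_def)
  have sB: "s ` B \<subseteq> hom_idx n (2 * m)"
    using hom_idx_add[of _ n m _ m] by (auto simp: B_def s_def mult_2)
  have square: "(hom_part n m c z)\<^sup>2 = (\<Sum>\<gamma>\<in>hom_idx n (2 * m). e \<gamma> * Defs.monom n z \<gamma>)" for z
  proof -
    have "(hom_part n m c z)\<^sup>2 = (\<Sum>p\<in>B. c (fst p) * c (snd p) * Defs.monom n z (s p))"
      by (simp add: hom_part_def power2_eq_square sum_product sum.cartesian_product B_def
          s_def monom_add case_prod_beta mult_ac)
    also have "\<dots> = (\<Sum>\<gamma>\<in>hom_idx n (2 * m). \<Sum>p\<in>{p \<in> B. s p = \<gamma>}.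
                      c (fst p) * c (snd p) * Defs.monom n z (s p))"
      by (rule sum.group[symmetric, OF fin _ sB]) simp
    finally show ?thesis by (simp add: e_def sum_distrib_right)
  qed
  have "(norm (e \<gamma>))\<^sup>2 \<le> 4 ^ m * (\<Sum>p\<in>{p \<in> B. s p = \<gamma>}. (norm (c (fst p)))\<^sup>2 * (norm (c (snd p)))\<^sup>2)"
    if \<gamma>: "\<gamma> \<in> hom_idx n (2 * m)" for \<gamma>
  proof -
    let ?F = "{p \<in> B. s p = \<gamma>}"
    let ?S = "{(\<alpha>, \<beta>). \<alpha> \<in> multi_idx n \<and> \<beta> \<in> multi_idx n \<and> (\<lambda>i. \<alpha> i + \<beta> i) = \<gamma>}"
    have "?S \<subseteq> idx_box n (\<lambda>i. Suc (\<gamma> i)) \<times> idx_box n (\<lambda>i. Suc (\<gamma> i))"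
      by (auto simp: idx_box_def)
    then have "finite ?S" by (rule finite_subset) simp
    moreover have "?F \<subseteq> ?S" by (auto simp: B_def s_def hom_idx_def)
    ultimately have "card ?F \<le> 2 ^ (2 * m)"
      using card_splittings_le[OF \<gamma>] card_mono[of ?S ?F] by linarith
    then have card: "real (card ?F) \<le> 4 ^ m"
      by (simp add: power_mult)
    have "(norm (e \<gamma>))\<^sup>2 \<le> (\<Sum>p\<in>?F. norm (c (fst p)) * norm (c (snd p)))\<^sup>2"
      unfolding e_def by (intro power_mono sum_norm_le) (auto simp: norm_mult)
    also have "\<dots> \<le> (\<Sum>p\<in>?F. (norm (c (fst p)) * norm (c (snd p)))\<^sup>2) * real (card ?F)"
      by (rule sum_squared_le_sum_of_squares)
    also have "\<dots> \<le> (\<Sum>p\<in>?F. (norm (c (fst p)) * norm (c (snd p)))\<^sup>2) * 4 ^ m"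
      by (intro mult_left_mono card sum_nonneg) auto
    finally show ?thesis by (simp add: power_mult_distrib mult.commute)
  qed
  then have "(\<Sum>\<gamma>\<in>hom_idx n (2 * m). (norm (e \<gamma>))\<^sup>2) \<le> (\<Sum>\<gamma>\<in>hom_idx n (2 * m).
      4 ^ m * (\<Sum>p\<in>{p \<in> B. s p = \<gamma>}. (norm (c (fst p)))\<^sup>2 * (norm (c (snd p)))\<^sup>2))"
    by (rule sum_mono)
  also have "\<dots> = 4 ^ m * (\<Sum>p\<in>B. (norm (c (fst p)))\<^sup>2 * (norm (c (snd p)))\<^sup>2)"
    unfolding sum_distrib_left[symmetric] by (subst sum.group[OF fin _ sB]) simp_all
  also have "\<dots> = 4 ^ m * (\<Sum>\<alpha>\<in>hom_idx n m. (norm (c \<alpha>))\<^sup>2)\<^sup>2"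
    by (simp add: power2_eq_square[of "sum _ _"] sum_product sum.cartesian_product B_def case_prod_beta)
  finally have *: "(\<Sum>\<gamma>\<in>hom_idx n (2 * m). (norm (e \<gamma>))\<^sup>2) \<le> 4 ^ m * (\<Sum>\<alpha>\<in>hom_idx n m. (norm (c \<alpha>))\<^sup>2)\<^sup>2" .
  have "(\<Sum>\<beta>\<in>grid n M. norm (hom_part n m c (grid_pt M \<beta>)) ^ 4)
      = (\<Sum>\<beta>\<in>grid n M. (norm ((hom_part n m c (grid_pt M \<beta>))\<^sup>2))\<^sup>2)"
    by (simp add: norm_power power_mult[symmetric])
  also have "\<dots> = real M ^ n * (\<Sum>\<gamma>\<in>hom_idx n (2 * m). (norm (e \<gamma>))\<^sup>2)"
    unfolding square using assms hom_idx_subset_grid by (intro grid_parseval) auto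
  finally show ?thesis using * by (simp add: mult_left_mono)
qed

lemma hom_part_second_moment:
  assumes "m < M"
  shows "(\<Sum>\<beta>\<in>grid n M. (norm (hom_part n m c (grid_pt M \<beta>)))\<^sup>2)
       = real M ^ n * (\<Sum>\<alpha>\<in>hom_idx n m. (norm (c \<alpha>))\<^sup>2)"
  unfolding hom_part_def using assms hom_idx_subset_grid by (intro grid_parseval) auto

text \<open>A fourth moment comparable to the square of the second keeps the polynomial from
  concentrating on few points, so its first moment cannot be small.\<close>

lemma hom_part_l2_le_l1:
  assumes "2 * m < M"
  shows "real M ^ n * sqrt (\<Sum>\<alpha>\<in>hom_idx n m. (norm (c \<alpha>))\<^sup>2)
       \<le> 4 * 2 ^ m * (\<Sum>\<beta>\<in>grid n M. norm (hom_part n m c (grid_pt M \<beta>)))"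
proof -
  define S where "S = (\<Sum>\<alpha>\<in>hom_idx n m. (norm (c \<alpha>))\<^sup>2)"
  define Q where "Q \<beta> = norm (hom_part n m c (grid_pt M \<beta>))" for \<beta>
  have S0: "S \<ge> 0" by (simp add: S_def sum_nonneg)
  show ?thesis
  proof (cases "S = 0")
    case True
    then show ?thesis unfolding S_def[symmetric] by (simp add: sum_nonneg)
  next
    case False
    then have S: "S > 0" using S0 by simp
    \<comment> \<open>This threshold makes the bound for the fourth moment term a quarter of the
      second moment, which is absorbed on the left; cancelling \<open>sqrt S\<close> leaves the
      constant 8/3, rounded up to 4.\<close>
    define l where "l = 2 * 2 ^ m * sqrt S"
    have l: "l > 0" using S by (simp add: l_def)
    have l2: "l\<^sup>2 = 4 * 4 ^ m * S"
      using S by (simp add: l_def power_mult_distrib power_mult[symmetric] mult.commute[of m]) (simp add: power_mult)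
    \<comment> \<open>interpolates the second moment between the first and the fourth\<close>
    have interp: "t\<^sup>2 \<le> l * t + t ^ 4 / l\<^sup>2" if "t \<ge> 0" for t :: real
    proof (cases "t \<le> l")
      case True
      then have "t\<^sup>2 \<le> l * t" using that by (simp add: power2_eq_square mult_right_mono)
      then show ?thesis using l by (smt (verit) divide_nonneg_nonneg zero_le_even_power' even_numeral zero_le_power that)
    next
      case False
      then have "t\<^sup>2 * l\<^sup>2 \<le> t\<^sup>2 * t\<^sup>2" using l by (intro mult_left_mono power_mono) auto
      then have "t\<^sup>2 \<le> t ^ 4 / l\<^sup>2" using l by (simp add: field_simps power_add[symmetric])
      then show ?thesis using l that by (smt (verit) mult_nonneg_nonneg)
    qed
    have "real M ^ n * S = (\<Sum>\<beta>\<in>grid n M. (Q \<beta>)\<^sup>2)"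
      using assms by (simp add: Q_def S_def hom_part_second_moment)
    also have "\<dots> \<le> (\<Sum>\<beta>\<in>grid n M. l * Q \<beta> + Q \<beta> ^ 4 / l\<^sup>2)"
      by (intro sum_mono interp) (simp add: Q_def)
    also have "\<dots> = l * (\<Sum>\<beta>\<in>grid n M. Q \<beta>) + (\<Sum>\<beta>\<in>grid n M. Q \<beta> ^ 4) / l\<^sup>2"
      by (simp add: sum.distrib sum_distrib_left sum_divide_distrib)
    also have "\<dots> \<le> l * (\<Sum>\<beta>\<in>grid n M. Q \<beta>) + (real M ^ n * (4 ^ m * S\<^sup>2)) / l\<^sup>2"
      using hom_part_fourth_moment[OF assms, of n c]
      by (intro add_left_mono divide_right_mono) (auto simp: Q_def S_def)
    also have "(real M ^ n * (4 ^ m * S\<^sup>2)) / l\<^sup>2 = real M ^ n * S / 4"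
      using S unfolding l2 by (simp add: field_simps power2_eq_square)
    finally have "real M ^ n * S * (3 / 4) \<le> 2 * 2 ^ m * sqrt S * (\<Sum>\<beta>\<in>grid n M. Q \<beta>)"
      by (simp add: l_def)
    moreover have "sqrt S * (real M ^ n * sqrt S * (3 / 4)) = sqrt S * sqrt S * real M ^ n * (3 / 4)"
      by (simp only: mult_ac)
    ultimately have "sqrt S * (real M ^ n * sqrt S * (3 / 4)) \<le> sqrt S * (2 * 2 ^ m * (\<Sum>\<beta>\<in>grid n M. Q \<beta>))"
      by (simp only: real_sqrt_mult_self abs_of_pos[OF S] mult_ac)
    then have "real M ^ n * sqrt S * (3 / 4) \<le> 2 * 2 ^ m * (\<Sum>\<beta>\<in>grid n M. Q \<beta>)"
      using S by (subst (asm) mult_le_cancel_left_pos) auto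
    moreover have "0 \<le> real M ^ n * sqrt S" using S by simp
    ultimately have "real M ^ n * sqrt S \<le> 4 * 2 ^ m * (\<Sum>\<beta>\<in>grid n M. Q \<beta>)" by linarith
    then show ?thesis by (simp add: S_def Q_def)
  qed
qed

section \<open>Caratheodory's coefficient bound\<close>

text \<open>Discrete Herglotz argument: \<open>b k\<close> is a Fourier coefficient of the
  nonnegative samples \<open>2 * Re (g j) + 2 * \<epsilon>\<close>, whose average is
  \<open>2 + 2 * \<epsilon>\<close> because \<open>b 0 = 1\<close>.\<close>

lemma caratheodory_coeff_poly:
  fixes b :: "nat \<Rightarrow> complex"
  assumes re: "\<And>t. norm t = 1 \<Longrightarrow> Re (\<Sum>l<N. b l * t ^ l) \<ge> - \<epsilon>"
    and b0: "b 0 = 1" and k: "0 < k" "k < N"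
  shows "norm (b k) \<le> 2 + 2 * \<epsilon>"
proof -
  \<comment> \<open>With \<open>2 * N\<close> sample points the frequencies \<open>- l - k\<close>
    coming from \<open>cnj (g j)\<close> are never divisible by \<open>M\<close>, so adding the
    conjugate leaves the coefficient unchanged.\<close>
  define M where "M = 2 * N"
  have M: "M > 0" using k by (simp add: M_def)
  define g where "g j = (\<Sum>l<N. b l * root_unity M (int j * int l))" for j
  have g: "Re (g j) \<ge> - \<epsilon>" for j
    using re[of "root_unity M (int j)"] by (simp add: g_def root_unity_power)
  have coeff: "(\<Sum>j<M. g j * root_unity M (int j * - int i)) = of_nat M * b i" if "i < N" for i
  proof -
    have "(\<Sum>j<M. g j * root_unity M (int j * - int i))
        = (\<Sum>j<M. \<Sum>l<N. b l * root_unity M (int j * (int l - int i)))"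
      by (simp add: g_def sum_distrib_right root_unity_add[symmetric] mult.assoc right_diff_distrib)
    also have "\<dots> = (\<Sum>l<N. b l * (\<Sum>j<M. root_unity M (int j * (int l - int i))))"
      by (subst sum.swap) (simp add: sum_distrib_left)
    also have "\<dots> = (\<Sum>l<N. if l = i then b l * of_nat M else 0)"
    proof (intro sum.cong refl)
      fix l assume "l \<in> {..<N}"
      then have "int M dvd int l - int i \<longleftrightarrow> l = i"
        using zdvd_imp_le[of "int M" "\<bar>int l - int i\<bar>"] that by (fastforce simp: M_def)
      then show "b l * (\<Sum>j<M. root_unity M (int j * (int l - int i))) = (if l = i then b l * of_nat M else 0)"
        by (simp add: sum_root_unity M)
    qed
    finally show ?thesis using that by simp
  qed
  have cnj: "(\<Sum>j<M. cnj (g j) * root_unity M (int j * - int k)) = 0"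
  proof -
    have "(\<Sum>j<M. cnj (g j) * root_unity M (int j * - int k))
        = (\<Sum>j<M. \<Sum>l<N. cnj (b l) * root_unity M (int j * (- int l - int k)))"
      by (simp add: g_def cnj_root_unity sum_distrib_right root_unity_add[symmetric] mult.assoc right_diff_distrib)
    also have "\<dots> = (\<Sum>l<N. cnj (b l) * (\<Sum>j<M. root_unity M (int j * (- int l - int k))))"
      by (subst sum.swap) (simp add: sum_distrib_left)
    also have "\<dots> = 0"
    proof (intro sum.neutral ballI)
      fix l assume "l \<in> {..<N}"
      then have "\<not> int M dvd - int l - int k"
        using zdvd_imp_le[of "int M" "int l + int k"] k
          dvd_minus_iff[of "int M" "int l + int k"] by (auto simp: M_def)
      then show "cnj (b l) * (\<Sum>j<M. root_unity M (int j * (- int l - int k))) = 0"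
        by (simp add: sum_root_unity M)
    qed
    finally show ?thesis .
  qed
  have const: "(\<Sum>j<M. root_unity M (int j * - int k)) = 0"
    using zdvd_imp_le[of "int M" "int k"] k by (subst sum_root_unity[OF M]) (auto simp: M_def)
  have "of_nat M * b k = (\<Sum>j<M. (g j + cnj (g j) + of_real (2 * \<epsilon>)) * root_unity M (int j * - int k))"
    unfolding distrib_right sum.distrib cnj coeff[OF k(2)] sum_distrib_left[symmetric] const by simp
  also have "\<dots> = (\<Sum>j<M. of_real (2 * Re (g j) + 2 * \<epsilon>) * root_unity M (int j * - int k))"
    by (simp add: complex_add_cnj)
  finally have eq: "of_nat M * b k
      = (\<Sum>j<M. of_real (2 * Re (g j) + 2 * \<epsilon>) * root_unity M (int j * - int k))" .
  have "0 \<le> 2 * Re (g j) + 2 * \<epsilon>" for j using g[of j] by linarith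
  then have "norm (of_nat M * b k) \<le> (\<Sum>j<M. 2 * Re (g j) + 2 * \<epsilon>)"
    unfolding eq by (intro sum_norm_le) (simp only: norm_mult norm_of_real norm_root_unity abs_of_nonneg, simp)
  also have "\<dots> = 2 * Re (\<Sum>j<M. g j) + M * (2 * \<epsilon>)"
    by (simp add: sum.distrib sum_distrib_left)
  also have "(\<Sum>j<M. g j) = of_nat M"
    using coeff[of 0] k b0 by simp
  finally have "M * norm (b k) \<le> M * (2 + 2 * \<epsilon>)"
    by (simp add: norm_mult distrib_left)
  then show ?thesis using M by simp
qed

lemma caratheodory_coeff:
  fixes a :: "nat \<Rightarrow> complex"
  assumes sm: "\<And>t. norm t < 1 \<Longrightarrow> summable (\<lambda>k. norm (a k * t ^ k))"
    and pos: "\<And>t. norm t < 1 \<Longrightarrow> Re (\<Sum>k. a k * t ^ k) > 0"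
    and a0: "a 0 = 1" and k: "k > 0"
  shows "norm (a k) \<le> 2"
proof -
  have bound: "norm (a k) * r ^ k \<le> 2" if r: "0 < r" "r < 1" for r :: real
  proof (rule field_le_epsilon)
    fix e :: real assume e: "e > 0"
    define b where "b l = a l * of_real r ^ l" for l
    have sb: "summable (\<lambda>l. norm (b l))" using sm[of "of_real r"] r by (simp add: b_def)
    obtain N0 where N0: "\<And>n. n \<ge> N0 \<Longrightarrow> norm (\<Sum>i. norm (b (i + n))) < e / 2"
      using suminf_exist_split[OF _ sb, of "e / 2"] e by auto
    define N where "N = max N0 (Suc k)"
    have "Re (\<Sum>l<N. b l * t ^ l) \<ge> - (e / 2)" if t: "norm t = 1" for t
    proof -
      have nt: "norm (b l * t ^ l) = norm (b l)" for l using t by (simp add: norm_mult norm_power)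
      have s: "summable (\<lambda>l. norm (b l * t ^ l))" using sb by (simp add: nt)
      have eq: "b l * t ^ l = a l * (of_real r * t) ^ l" for l
        by (simp add: b_def power_mult_distrib)
      have "norm (of_real r * t) < 1" using r t by (simp add: norm_mult)
      then have "0 < Re (\<Sum>l. b l * t ^ l)"
        using pos[of "of_real r * t"] by (simp add: eq)
      also have "(\<Sum>l. b l * t ^ l) = (\<Sum>l. b (l + N) * t ^ (l + N)) + (\<Sum>l<N. b l * t ^ l)"
        by (rule suminf_split_initial_segment) (rule summable_norm_cancel[OF s])
      finally have "0 < Re (\<Sum>l. b (l + N) * t ^ (l + N)) + Re (\<Sum>l<N. b l * t ^ l)" by simp
      moreover have "norm (\<Sum>l. b (l + N) * t ^ (l + N)) \<le> (\<Sum>l. norm (b (l + N) * t ^ (l + N)))"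
        by (rule summable_norm) (rule summable_ignore_initial_segment[OF s])
      moreover have "(\<Sum>l. norm (b (l + N) * t ^ (l + N))) < e / 2"
        using N0[of N] by (simp add: nt N_def)
      moreover have "Re (\<Sum>l. b (l + N) * t ^ (l + N)) \<le> norm (\<Sum>l. b (l + N) * t ^ (l + N))"
        by (rule complex_Re_le_cmod)
      ultimately show ?thesis by linarith
    qed
    then have "norm (b k) \<le> 2 + 2 * (e / 2)"
      by (rule caratheodory_coeff_poly) (use a0 k in \<open>auto simp: b_def N_def\<close>)
    then show "norm (a k) * r ^ k \<le> 2 + e" using r by (simp add: b_def norm_mult norm_power)
  qed
  have "((\<lambda>r. norm (a k) * r ^ k) \<longlongrightarrow> norm (a k) * 1 ^ k) (at_left (1::real))"
    by (intro tendsto_intros)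
  moreover have "\<forall>\<^sub>F r in at_left (1::real). norm (a k) * r ^ k \<le> 2"
    by (rule eventually_mono[OF eventually_at_left_real[of 0 1]]) (use bound in auto)
  ultimately show ?thesis
    using tendsto_upperbound[of "\<lambda>r. norm (a k) * r ^ k" "norm (a k) * 1 ^ k" "at_left 1" 2]
    by (simp add: trivial_limit_at_left_real)
qed

section \<open>Expansion into homogeneous parts on complex lines\<close>

lemma monom_scale:
  "\<alpha> \<in> hom_idx n k \<Longrightarrow> Defs.monom n (\<lambda>i. t * z i) \<alpha> = t ^ k * Defs.monom n z \<alpha>"
  by (auto simp: Defs.monom_def hom_idx_def power_mult_distrib prod.distrib power_sum)

lemma hom_part_scale: "hom_part n k c (\<lambda>i. t * z i) = t ^ k * hom_part n k c z"
  by (simp add: hom_part_def monom_scale sum_distrib_left mult_ac)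

lemma bij_betw_snd_hom_idx: "bij_betw snd (Sigma UNIV (hom_idx n)) (multi_idx n)"
  by (auto simp: bij_betw_def inj_on_def hom_idx_def image_iff)

text \<open>Summability over \<open>multi_idx n\<close> is unconditional, so the terms may be
  grouped by degree; each degree has finitely many multi-indices.\<close>

lemma pser_homogeneous_expansion:
  assumes "(\<lambda>\<alpha>. x \<alpha> * Defs.monom n z \<alpha>) summable_on multi_idx n"
  shows "summable (\<lambda>k. norm (hom_part n k x z))" "pser n x z = (\<Sum>k. hom_part n k x z)"
proof -
  let ?f = "\<lambda>\<alpha>. x \<alpha> * Defs.monom n z \<alpha>"
  have sm: "(\<lambda>p. ?f (snd p)) summable_on Sigma UNIV (hom_idx n)"
    using assms summable_on_reindex_bij_betw[OF bij_betw_snd_hom_idx, of ?f] by simp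
  have h: "(\<Sum>\<^sub>\<infinity>\<alpha>\<in>hom_idx n k. ?f \<alpha>) = hom_part n k x z" for k
    by (simp add: hom_part_def)
  have "(\<lambda>k. \<Sum>\<^sub>\<infinity>\<alpha>\<in>hom_idx n k. ?f \<alpha>) summable_on UNIV"
    by (rule summable_on_Sigma_banach) (use sm in \<open>simp add: case_prod_unfold\<close>)
  then have s: "(\<lambda>k. hom_part n k x z) summable_on UNIV" by (simp add: h)
  then have "(\<lambda>k. norm (hom_part n k x z)) summable_on UNIV"
    by (simp add: summable_on_iff_abs_summable_on_complex)
  then show "summable (\<lambda>k. norm (hom_part n k x z))" by (rule summable_on_imp_summable)
  have "pser n x z = (\<Sum>\<^sub>\<infinity>p\<in>Sigma UNIV (hom_idx n). ?f (snd p))"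
    unfolding pser_def by (rule infsum_reindex_bij_betw[OF bij_betw_snd_hom_idx, symmetric])
  also have "\<dots> = (\<Sum>\<^sub>\<infinity>k. hom_part n k x z)"
    using infsum_Sigma_banach[OF sm] by (simp add: h)
  finally show "pser n x z = (\<Sum>k. hom_part n k x z)"
    using has_sum_imp_sums[OF has_sum_infsum[OF s]] by (simp add: sums_iff)
qed

text \<open>The numbers \<open>hom_part n k x z\<close> are the Taylor coefficients of
  \<open>f\<close> along the line of points \<open>t * z i\<close>. For \<open>norm t < 1\<close>
  these points stay in the open polydisk even if \<open>z\<close> lies on the torus.\<close>

lemma carath_hom_part_le:
  assumes x: "carath_class n x" and k: "k > 0" and z: "\<And>i. i < n \<Longrightarrow> norm (z i) \<le> 1"
  shows "norm (hom_part n k x z) \<le> 2"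
proof (rule caratheodory_coeff[OF _ _ _ k])
  fix t :: complex assume t: "norm t < 1"
  have "(\<lambda>i. t * z i) \<in> polydisk n 1"
    using t z by (auto simp: polydisk_def norm_mult intro: le_less_trans[OF mult_left_le])
  then have sm: "(\<lambda>\<alpha>. x \<alpha> * Defs.monom n (\<lambda>i. t * z i) \<alpha>) summable_on multi_idx n"
    and pos: "Re (pser n x (\<lambda>i. t * z i)) > 0"
    using x by (auto simp: carath_class_def)
  show "summable (\<lambda>k. norm (hom_part n k x z * t ^ k))"
    using pser_homogeneous_expansion(1)[OF sm] by (simp add: hom_part_scale mult.commute)
  show "Re (\<Sum>k. hom_part n k x z * t ^ k) > 0"
    using pos pser_homogeneous_expansion(2)[OF sm] by (simp add: hom_part_scale mult.commute)
next
  show "hom_part n 0 x z = 1"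
    using x by (simp add: hom_part_def hom_idx_0 Defs.monom_def carath_class_def)
qed

lemma carath_l2_le:
  assumes x: "carath_class n x" and k: "k > 0"
  shows "(\<Sum>\<alpha>\<in>hom_idx n k. (norm (x \<alpha>))\<^sup>2) \<le> 4"
proof -
  define M where "M = Suc k"
  have "real M ^ n * (\<Sum>\<alpha>\<in>hom_idx n k. (norm (x \<alpha>))\<^sup>2)
      = (\<Sum>\<beta>\<in>grid n M. (norm (hom_part n k x (grid_pt M \<beta>)))\<^sup>2)"
    by (rule hom_part_second_moment[symmetric]) (simp add: M_def)
  also have "\<dots> \<le> (\<Sum>\<beta>\<in>grid n M. 2\<^sup>2)"
    by (intro sum_mono power_mono carath_hom_part_le[OF x k]) auto
  also have "\<dots> = real M ^ n * 4" by simp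
  finally show ?thesis by (simp add: M_def)
qed

section \<open>Radial derivatives and counting of monomials\<close>

text \<open>With phases \<open>u i\<close> that make each radial derivative nonnegative, the sum is
  the derivative at 0 of the polynomial along the points \<open>z i * (1 + t * u i)\<close>.
  Cauchy's estimate on the circle of radius \<open>1 / m\<close> costs the factor \<open>m\<close>,
  and homogeneity costs \<open>(1 + 1 / m) ^ m \<le> 3\<close>.\<close>

lemma sum_norm_radial_derivatives_le:
  fixes c :: "(nat \<Rightarrow> nat) \<Rightarrow> complex"
  assumes B: "\<And>z. (\<And>i. i < n \<Longrightarrow> norm (z i) \<le> 1) \<Longrightarrow> norm (hom_part n m c z) \<le> B"
    and m: "m > 0" and z: "\<And>i. i < n \<Longrightarrow> norm (z i) \<le> 1"
  shows "(\<Sum>i<n. norm (hom_part n m (\<lambda>\<alpha>. of_nat (\<alpha> i) * c \<alpha>) z)) \<le> 3 * m * B"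
proof -
  define R where "R i = hom_part n m (\<lambda>\<alpha>. of_nat (\<alpha> i) * c \<alpha>) z" for i
  define u where "u i = cnj (sgn (R i))" for i
  have u: "norm (u i) \<le> 1" for i by (simp add: u_def norm_sgn)
  have uR: "u i * R i = of_real (norm (R i))" for i
    by (simp add: u_def sgn_eq complex_norm_square[symmetric] mult.commute[of "cnj _"] power2_eq_square)
  define h where "h t = hom_part n m c (\<lambda>i. z i * (1 + t * u i))" for t
  have h: "h t = (\<Sum>\<alpha>\<in>hom_idx n m. c \<alpha> * Defs.monom n z \<alpha> * (\<Prod>i<n. (1 + t * u i) ^ \<alpha> i))" for t
    by (simp add: h_def hom_part_def Defs.monom_def power_mult_distrib prod.distrib mult.assoc)
  have d: "((\<lambda>t. \<Prod>i<n. (1 + t * u i) ^ \<alpha> i) has_field_derivative (\<Sum>i<n. of_nat (\<alpha> i) * u i)) (at 0)" for \<alpha>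
    by (rule has_field_derivative_prod[THEN DERIV_cong]) (auto intro!: derivative_eq_intros sum.cong)
  have "(h has_field_derivative (\<Sum>\<alpha>\<in>hom_idx n m. c \<alpha> * Defs.monom n z \<alpha> * (\<Sum>i<n. of_nat (\<alpha> i) * u i))) (at 0)"
    unfolding h by (intro DERIV_sum DERIV_cmult d)
  then have "deriv h 0 = (\<Sum>\<alpha>\<in>hom_idx n m. c \<alpha> * Defs.monom n z \<alpha> * (\<Sum>i<n. of_nat (\<alpha> i) * u i))"
    by (rule DERIV_imp_deriv)
  also have "\<dots> = (\<Sum>i<n. u i * R i)"
    unfolding sum_distrib_left R_def hom_part_def by (subst sum.swap) (simp add: mult_ac)
  finally have deriv: "deriv h 0 = of_real (\<Sum>i<n. norm (R i))" unfolding uR of_real_sum .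
  define r where "r = 1 + 1 / real m"
  have r: "r > 0" by (simp add: r_def add_pos_nonneg)
  have B0: "B \<ge> 0" using order_trans[OF norm_ge_zero B[of "\<lambda>_. 0"]] by simp
  have "r ^ m \<le> exp 1" using exp_ge_one_plus_x_over_n_power_n[of m 1] m by (simp add: r_def)
  then have r3: "r ^ m \<le> 3" using exp_le by linarith
  have hB: "norm (h t) \<le> 3 * B" if t: "norm (0 - t) = 1 / m" for t
  proof -
    have "norm (hom_part n m c (\<lambda>i. z i * (1 + t * u i) / of_real r)) \<le> B"
    proof (rule B)
      fix i assume "i < n"
      have "norm (1 + t * u i) \<le> 1 + norm t * norm (u i)"
        by (metis norm_mult norm_one norm_triangle_ineq)
      also have "\<dots> \<le> r" using u[of i] t m by (simp add: r_def divide_right_mono)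
      finally have "norm (z i) * norm (1 + t * u i) \<le> 1 * r"
        using z[OF \<open>i < n\<close>] r by (intro mult_mono) auto
      then show "norm (z i * (1 + t * u i) / of_real r) \<le> 1"
        using r by (simp add: norm_mult norm_divide)
    qed
    moreover have "h t = of_real r ^ m * hom_part n m c (\<lambda>i. z i * (1 + t * u i) / of_real r)"
      using r unfolding h_def hom_part_scale[symmetric] by simp
    ultimately have "norm (h t) \<le> r ^ m * B" using r by (simp add: norm_mult norm_power)
    also have "\<dots> \<le> 3 * B" using r3 B0 by (rule mult_right_mono)
    finally show ?thesis .
  qed
  have hol: "h holomorphic_on UNIV" unfolding h by (intro holomorphic_intros)
  have "norm ((deriv ^^ 1) h 0) \<le> fact 1 * (3 * B) / (1 / m) ^ 1"
    by (rule Cauchy_inequality)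
       (use hol m hB in \<open>auto intro: holomorphic_on_subset holomorphic_on_imp_continuous_on\<close>)
  then have "norm (deriv h 0) \<le> 3 * m * B" by (simp add: mult_ac)
  moreover have "norm (deriv h 0) = (\<Sum>i<n. norm (R i))"
    unfolding deriv norm_of_real by (simp add: sum_nonneg)
  ultimately show ?thesis by (simp add: R_def)
qed

text \<open>After division by the mean \<open>\<mu>\<close>, the pointwise bound
  \<open>u powr p \<le> 1 + u powr q\<close> sums to at most \<open>2 * N\<close>. This loses a
  factor 2 against Hoelder's inequality.\<close>

lemma sum_powr_le_power_mean:
  fixes t :: "'a \<Rightarrow> real"
  assumes fin: "finite A" and t: "\<And>a. a \<in> A \<Longrightarrow> t a \<ge> 0" and pq: "0 < p" "p \<le> q"
    and N: "real (card A) \<le> N" "N > 0" and S: "(\<Sum>a\<in>A. t a powr q) \<le> S"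
  shows "(\<Sum>a\<in>A. t a powr p) \<le> 2 * N powr (1 - p / q) * S powr (p / q)"
proof (cases "S > 0")
  case False
  then have "(\<Sum>a\<in>A. t a powr q) = 0" using S sum_nonneg[of A "\<lambda>a. t a powr q"] by simp
  then have "\<forall>a\<in>A. t a = 0" using fin by (subst (asm) sum_nonneg_eq_0_iff) auto
  then have "(\<Sum>a\<in>A. t a powr p) = 0" by simp
  then show ?thesis by simp
next
  case True
  define \<mu> where "\<mu> = (S / N) powr (1 / q)"
  have \<mu>: "\<mu> > 0" using True N by (simp add: \<mu>_def)
  have \<mu>q: "\<mu> powr q = S / N" using True N pq by (simp add: \<mu>_def powr_powr)
  have \<mu>p: "\<mu> powr p = (S / N) powr (p / q)" by (simp add: \<mu>_def powr_powr)
  have "t a powr p \<le> \<mu> powr p * (1 + t a powr q / \<mu> powr q)" if "a \<in> A" for a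
  proof -
    have ta: "t a \<ge> 0" using t that by simp
    have "(t a / \<mu>) powr p \<le> 1 + (t a / \<mu>) powr q"
    proof (cases "t a / \<mu> \<le> 1")
      case True
      then have "(t a / \<mu>) powr p \<le> 1" using ta \<mu> pq by (intro powr_le1) auto
      moreover have "(t a / \<mu>) powr q \<ge> 0" by simp
      ultimately show ?thesis by linarith
    next
      case False
      then have "(t a / \<mu>) powr p \<le> (t a / \<mu>) powr q" using pq by (intro powr_mono) auto
      then show ?thesis by linarith
    qed
    then show ?thesis using ta \<mu> by (simp add: powr_divide field_simps)
  qed
  then have "(\<Sum>a\<in>A. t a powr p) \<le> (\<Sum>a\<in>A. \<mu> powr p * (1 + t a powr q / \<mu> powr q))"
    by (rule sum_mono)
  also have "\<dots> = \<mu> powr p * (card A + (\<Sum>a\<in>A. t a powr q) / \<mu> powr q)"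
    by (simp add: sum_distrib_left[symmetric] sum.distrib sum_divide_distrib)
  also have "\<dots> \<le> \<mu> powr p * (N + S / \<mu> powr q)"
    using N S by (intro mult_left_mono add_mono divide_right_mono) auto
  also have "\<dots> = 2 * (N * \<mu> powr p)" using True N by (simp add: \<mu>q)
  also have "N * \<mu> powr p = N powr (1 - p / q) * S powr (p / q)"
    using True N by (simp add: \<mu>p powr_divide powr_diff)
  finally show ?thesis by simp
qed

text \<open>The left side is one term of the power series of \<open>(1 / (1 - t)) ^ n\<close>, the
  generating function of these cardinalities; cutting all exponents at \<open>k\<close> keeps the
  sums finite.\<close>

lemma card_hom_idx_le:
  fixes t :: real
  assumes t: "0 < t" "t < 1"
  shows "real (card (hom_idx n k)) * t ^ k \<le> (1 / (1 - t)) ^ n"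
proof -
  have "real (card (hom_idx n k)) * t ^ k = (\<Sum>\<alpha>\<in>hom_idx n k. \<Prod>i<n. t ^ \<alpha> i)"
    by (simp add: hom_idx_def power_sum[symmetric])
  also have "\<dots> \<le> (\<Sum>\<alpha>\<in>grid n (Suc k). \<Prod>i<n. t ^ \<alpha> i)"
    using t hom_idx_subset_grid[of k "Suc k"] by (intro sum_mono2) (auto intro!: prod_nonneg)
  also have "\<dots> = (\<Prod>i<n. \<Sum>j<Suc k. t ^ j)" by (rule sum_idx_box_prod)
  also have "\<dots> \<le> (\<Prod>i<n. 1 / (1 - t))"
  proof (intro prod_mono conjI sum_nonneg)
    have "(\<Sum>j<Suc k. t ^ j) = (1 - t ^ Suc k) / (1 - t)"
      using t sum_gp_strict[of t "Suc k"] by simp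
    also have "\<dots> \<le> 1 / (1 - t)" using t by (intro divide_right_mono) auto
    finally show "(\<Sum>j<Suc k. t ^ j) \<le> 1 / (1 - t)" .
  qed (use t in auto)
  finally show ?thesis by simp
qed

text \<open>Lowering the exponent at \<open>i\<close> by one embeds the set into the multi-indices
  of degree \<open>m - 1\<close>.\<close>

lemma card_hom_idx_pos_le:
  assumes m: "m > 0" and n: "n > 0" "i < n"
  shows "real (card {\<alpha> \<in> hom_idx n m. \<alpha> i > 0}) \<le> (real (n + m) / m) ^ (m - 1) * exp m"
proof -
  have "card {\<alpha> \<in> hom_idx n m. \<alpha> i > 0} \<le> card (hom_idx n (m - 1))"
  proof (rule card_inj_on_le)
    show "inj_on (\<lambda>\<alpha>. \<alpha>(i := \<alpha> i - 1)) {\<alpha> \<in> hom_idx n m. \<alpha> i > 0}"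
    proof (rule inj_onI)
      fix \<alpha> \<beta> :: "nat \<Rightarrow> nat"
      assume *: "\<alpha> \<in> {\<alpha> \<in> hom_idx n m. \<alpha> i > 0}" "\<beta> \<in> {\<alpha> \<in> hom_idx n m. \<alpha> i > 0}"
        and eq: "\<alpha>(i := \<alpha> i - 1) = \<beta>(i := \<beta> i - 1)"
      show "\<alpha> = \<beta>"
      proof
        fix j show "\<alpha> j = \<beta> j"
          using fun_cong[OF eq, of j] * by (cases "j = i") auto
      qed
    qed
    show "(\<lambda>\<alpha>. \<alpha>(i := \<alpha> i - 1)) ` {\<alpha> \<in> hom_idx n m. \<alpha> i > 0} \<subseteq> hom_idx n (m - 1)"
    proof clarify
      fix \<alpha> assume \<alpha>: "\<alpha> \<in> hom_idx n m" "0 < \<alpha> i"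
      have "(\<Sum>j<n. \<alpha> j) = \<alpha> i + (\<Sum>j\<in>{..<n} - {i}. \<alpha> j)"
        using n by (intro sum.remove) auto
      moreover have "(\<Sum>j<n. (\<alpha>(i := \<alpha> i - 1)) j) = (\<alpha> i - 1) + (\<Sum>j\<in>{..<n} - {i}. \<alpha> j)"
        using n by (subst sum.remove[of _ i]) auto
      ultimately show "\<alpha>(i := \<alpha> i - 1) \<in> hom_idx n (m - 1)"
        using \<alpha> n by (auto simp: hom_idx_def multi_idx_def)
    qed
  qed simp
  also have "real (card (hom_idx n (m - 1))) \<le> (real (n + m) / m) ^ (m - 1) * exp m"
  proof -
    \<comment> \<open>Then \<open>1 / (1 - t) = 1 + m / n\<close>, whose \<open>n\<close>-th power
      is at most \<open>exp m\<close>, while \<open>1 / t ^ (m - 1)\<close> is the other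
      factor.\<close>
    define t where "t = real m / real (n + m)"
    have t: "0 < t" "t < 1" using m n by (auto simp: t_def)
    have "1 / (1 - t) = 1 + real m / real n" using m n by (simp add: t_def field_simps)
    then have "(1 / (1 - t)) ^ n \<le> exp m"
      using exp_ge_one_plus_x_over_n_power_n[of n "real m"] n by simp
    then have "real (card (hom_idx n (m - 1))) * t ^ (m - 1) \<le> exp m"
      using card_hom_idx_le[OF t, of n "m - 1"] by linarith
    then have "real (card (hom_idx n (m - 1))) \<le> exp m / t ^ (m - 1)"
      using t by (simp add: field_simps)
    also have "\<dots> = (real (n + m) / m) ^ (m - 1) * exp m"
      by (simp add: t_def power_divide)
    finally show ?thesis .
  qed
  finally show ?thesis by simp
qed

section \<open>Lower bounds\<close>

lemma carath_sum_powr_le: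
  fixes p :: real
  assumes x: "carath_class n x" and p: "0 < p" "p < 2" and m: "m > 0" and n: "n > 0"
  shows "(\<Sum>\<alpha>\<in>hom_idx n m. norm (x \<alpha>) powr p)
       \<le> 4 * ((real (n + m) / m) ^ (m - 1) * exp m) powr (1 - p / 2)
           * real n powr max 0 (1 - p) * (24 * 4 ^ m) powr p"
proof -
  define N where "N = (real (n + m) / m) ^ (m - 1) * exp m"
  have N: "N > 0" using m n by (simp add: N_def)
  define d where "d i \<alpha> = of_nat (\<alpha> i) * x \<alpha>" for i and \<alpha> :: "nat \<Rightarrow> nat"
  define b where "b i = sqrt (\<Sum>\<alpha>\<in>hom_idx n m. (norm (d i \<alpha>))\<^sup>2)" for i
  have b0: "b i \<ge> 0" for i by (simp add: b_def sum_nonneg)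
  define T :: real where "T = 24 * 4 ^ m"
  have T: "T > 0" by (simp add: T_def)
  \<comment> \<open>The l2-norms are compared with grid averages before summing over
    \<open>i\<close>; at each grid point the radial derivatives sum to at most \<open>6 * m\<close>,
    and \<open>m \<le> 2 ^ m\<close> makes the bound geometric.\<close>
  have bT: "(\<Sum>i<n. b i) \<le> T"
  proof -
    define M where "M = Suc (2 * m)"
    have M: "real M ^ n > 0" by (simp add: M_def)
    have "real M ^ n * (\<Sum>i<n. b i)
        \<le> (\<Sum>i<n. 4 * 2 ^ m * (\<Sum>\<beta>\<in>grid n M. norm (hom_part n m (d i) (grid_pt M \<beta>))))"
      unfolding sum_distrib_left[of "real M ^ n"] b_def
      by (intro sum_mono hom_part_l2_le_l1) (simp add: M_def)
    also have "\<dots> = 4 * 2 ^ m * (\<Sum>\<beta>\<in>grid n M. \<Sum>i<n. norm (hom_part n m (d i) (grid_pt M \<beta>)))"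
      unfolding sum_distrib_left[symmetric] by (subst sum.swap) simp
    also have "\<dots> \<le> 4 * 2 ^ m * (\<Sum>\<beta>\<in>grid n M. 3 * real m * 2)"
      unfolding d_def using carath_hom_part_le[OF x m] m
      by (intro mult_left_mono sum_mono sum_norm_radial_derivatives_le) auto
    also have "\<dots> = real M ^ n * (24 * 2 ^ m * real m)" by simp
    finally have "(\<Sum>i<n. b i) \<le> 24 * 2 ^ m * real m" using M by simp
    also have "\<dots> \<le> 24 * 2 ^ m * 2 ^ m"
      using of_nat_mono[OF less_imp_le[OF less_exp[of m]], where ?'a = real] by (intro mult_left_mono) auto
    also have "\<dots> = T" by (simp add: T_def power_mult_distrib[symmetric])
    finally show ?thesis .
  qed
  \<comment> \<open>For \<open>p \<le> 1\<close> the power mean over \<open>n\<close> terms costs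
    \<open>real n powr (1 - p)\<close>; for \<open>p > 1\<close> the bound
    \<open>b i \<le> T\<close> gives the estimate without any power of \<open>n\<close>. The
    \<open>max\<close> covers both.\<close>
  have bp: "(\<Sum>i<n. b i powr p) \<le> 2 * real n powr max 0 (1 - p) * T powr p"
  proof (cases "p \<le> 1")
    case True
    then show ?thesis
      using sum_powr_le_power_mean[of "{..<n}" b p 1 "real n" T] b0 bT p n by simp
  next
    case False
    have "b i powr p \<le> b i * T powr (p - 1)" if "i < n" for i
    proof -
      have "b i \<le> T" using bT member_le_sum[of i "{..<n}" b] b0 that by auto
      then have "b i powr 1 * b i powr (p - 1) \<le> b i powr 1 * T powr (p - 1)"
        using False b0 by (intro mult_left_mono powr_mono2) auto
      then show ?thesis unfolding powr_add[symmetric] using b0 by simp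
    qed
    then have "(\<Sum>i<n. b i powr p) \<le> (\<Sum>i<n. b i * T powr (p - 1))" by (intro sum_mono) auto
    also have "\<dots> = (\<Sum>i<n. b i) * T powr (p - 1)" by (simp add: sum_distrib_right)
    also have "\<dots> \<le> T powr 1 * T powr (p - 1)" using bT T by (intro mult_right_mono) auto
    also have "\<dots> = T powr p" unfolding powr_add[symmetric] by simp
    also have "\<dots> \<le> 2 * T powr p" by simp
    finally show ?thesis using False n by simp
  qed
  \<comment> \<open>Covering by the sets \<open>A i\<close> costs nothing and lowers the number of monomials entering the power
    mean from degree \<open>m\<close> to degree \<open>m - 1\<close>; this gain is what produces the logarithm.\<close>
  define A where "A i = {\<alpha> \<in> hom_idx n m. \<alpha> i > 0}" for i
  have finA: "finite (A i)" for i by (simp add: A_def)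
  have "(\<Sum>\<alpha>\<in>hom_idx n m. norm (x \<alpha>) powr p)
      \<le> (\<Sum>\<alpha>\<in>hom_idx n m. \<Sum>i<n. if \<alpha> i > 0 then norm (x \<alpha>) powr p else 0)"
  proof (rule sum_mono)
    fix \<alpha> assume "\<alpha> \<in> hom_idx n m"
    then have "(\<Sum>i<n. \<alpha> i) \<noteq> 0" using m by (simp add: hom_idx_def)
    then obtain i where i: "i < n" "\<alpha> i > 0" by auto
    then show "norm (x \<alpha>) powr p \<le> (\<Sum>i<n. if \<alpha> i > 0 then norm (x \<alpha>) powr p else 0)"
      using member_le_sum[of i "{..<n}" "\<lambda>i. if \<alpha> i > 0 then norm (x \<alpha>) powr p else 0"] by simp
  qed
  also have "\<dots> = (\<Sum>i<n. \<Sum>\<alpha>\<in>A i. norm (x \<alpha>) powr p)"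
    by (subst sum.swap) (simp add: A_def sum.inter_filter)
  \<comment> \<open>On \<open>A i\<close> the factor \<open>\<alpha> i\<close> is at least 1, so
    passing to the coefficients \<open>d i\<close> of the radial derivative only increases the
    terms.\<close>
  also have "\<dots> \<le> (\<Sum>i<n. \<Sum>\<alpha>\<in>A i. norm (d i \<alpha>) powr p)"
  proof (intro sum_mono powr_mono2)
    fix i \<alpha> assume "\<alpha> \<in> A i"
    then have "1 \<le> real (\<alpha> i)" by (simp add: A_def)
    then show "norm (x \<alpha>) \<le> norm (d i \<alpha>)"
      using mult_right_mono[of 1 "real (\<alpha> i)" "norm (x \<alpha>)"] by (simp add: d_def norm_mult)
  qed (use p in auto)
  also have "\<dots> \<le> (\<Sum>i<n. 2 * N powr (1 - p / 2) * b i powr p)"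
  proof (intro sum_mono)
    fix i assume i: "i \<in> {..<n}"
    have "(\<Sum>\<alpha>\<in>A i. norm (d i \<alpha>) powr p)
        \<le> 2 * N powr (1 - p / 2) * (\<Sum>\<alpha>\<in>hom_idx n m. (norm (d i \<alpha>))\<^sup>2) powr (p / 2)"
    proof (rule sum_powr_le_power_mean)
      show "real (card (A i)) \<le> N"
        using card_hom_idx_pos_le[OF m n, of i] i by (simp add: N_def A_def)
      show "(\<Sum>\<alpha>\<in>A i. norm (d i \<alpha>) powr 2) \<le> (\<Sum>\<alpha>\<in>hom_idx n m. (norm (d i \<alpha>))\<^sup>2)"
        by (simp add: A_def) (intro sum_mono2, auto)
    qed (use finA p N in auto)
    also have "(\<Sum>\<alpha>\<in>hom_idx n m. (norm (d i \<alpha>))\<^sup>2) powr (p / 2) = b i powr p"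
      by (simp add: b_def powr_half_sqrt[symmetric] sum_nonneg powr_powr)
    finally show "(\<Sum>\<alpha>\<in>A i. norm (d i \<alpha>) powr p) \<le> 2 * N powr (1 - p / 2) * b i powr p" .
  qed
  also have "\<dots> = 2 * N powr (1 - p / 2) * (\<Sum>i<n. b i powr p)"
    by (simp add: sum_distrib_left)
  also have "\<dots> \<le> 2 * N powr (1 - p / 2) * (2 * real n powr max 0 (1 - p) * T powr p)"
    by (intro mult_left_mono bp) simp
  also have "\<dots> = 4 * N powr (1 - p / 2) * real n powr max 0 (1 - p) * T powr p" by simp
  finally show ?thesis by (simp add: N_def T_def)
qed

text \<open>For \<open>m\<close> far below \<open>ln n\<close> the base
  \<open>X = (n + m) / m\<close> is much larger than \<open>n / ln n\<close>. The exponent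
  \<open>m - 1\<close> in place of \<open>m\<close> supplies
  \<open>X powr (- a) \<le> (m / n) powr a\<close>, so a net \<open>real n powr (- \<delta>)\<close>
  remains, and this pays for the excess.\<close>

lemma powr_balance_le:
  fixes a \<delta> :: real
  assumes a: "0 < a" "a \<le> 1" and \<delta>: "\<delta> > 0" and m: "m > 0" and n: "n > 1"
  shows "((real (n + m) / m) ^ (m - 1)) powr a * real n powr (a - \<delta>)
       \<le> (2 * (1 + a / \<delta>) * (real n / ln n) powr a) ^ m"
proof -
  define X where "X = real (n + m) / m"
  define C where "C = 1 + a / \<delta>"
  define L where "L = ln (real n)"
  have L: "L > 0" using n by (simp add: L_def)
  have C: "C \<ge> 1" using a \<delta> by (simp add: C_def)
  have X: "X > 0" using m n by (simp add: X_def)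
  \<comment> \<open>Chosen so that \<open>E powr (m * a)\<close> is exactly
    \<open>real n powr \<delta>\<close>; since the exponential dominates its argument, also
    \<open>L / m \<le> a / \<delta> * E\<close>.\<close>
  define E where "E = real n powr (\<delta> / (a * m))"
  have E: "E = exp (\<delta> * L / (a * m))" using n by (simp add: E_def L_def powr_def)
  have E1: "E \<ge> 1" using a \<delta> L m by (simp add: E)
  have "\<delta> * L / (a * m) \<le> E" unfolding E using exp_ge_add_one_self[of "\<delta> * L / (a * m)"] by linarith
  then have "L / m \<le> a / \<delta> * E" using a \<delta> m by (simp add: field_simps)
  then have "n * (L / m) \<le> n * (a / \<delta> * E)" by (intro mult_left_mono) auto
  moreover have "L \<le> n * E"
  proof -
    have "L \<le> n" using n ln_le_minus_one[of "real n"] by (simp add: L_def)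
    also have "\<dots> \<le> n * E" using E1 mult_left_mono[of 1 E "real n"] by simp
    finally show ?thesis .
  qed
  moreover have "X * L = n * (L / m) + L" using m by (simp add: X_def field_simps)
  ultimately have "X * L \<le> C * E * n" by (simp add: C_def algebra_simps)
  then have XL: "X \<le> C * E * (n / L)" using L by (simp add: field_simps)
  have "(X ^ (m - 1)) powr a * real n powr (a - \<delta>) = X powr (real m * a) * X powr (- a) * real n powr (a - \<delta>)"
    using X m by (simp add: powr_realpow[symmetric] powr_powr powr_add[symmetric] of_nat_diff algebra_simps)
  also have "\<dots> \<le> X powr (real m * a) * (real m powr a * real n powr (- a)) * real n powr (a - \<delta>)"
  proof -
    have "real n / m \<le> X" using m by (simp add: X_def field_simps)
    then have "X powr (- a) \<le> (real n / m) powr (- a)" using a m n by (intro powr_mono2') auto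
    also have "\<dots> = real m powr a * real n powr (- a)"
      using m n by (simp add: powr_divide powr_minus field_simps)
    finally show ?thesis by (intro mult_right_mono mult_left_mono) auto
  qed
  also have "\<dots> = real m powr a * X powr (real m * a) * real n powr (- \<delta>)"
    using n by (simp add: powr_add[symmetric])
  also have "\<dots> \<le> 2 ^ m * (C ^ m * real n powr \<delta> * ((real n / L) powr a) ^ m) * real n powr (- \<delta>)"
  proof (intro mult_right_mono mult_mono)
    have "real m powr a \<le> real m powr 1" using a m by (intro powr_mono) auto
    also have "\<dots> \<le> 2 ^ m"
      using of_nat_mono[OF less_imp_le[OF less_exp[of m]], where ?'a = real] by simp
    finally show "real m powr a \<le> 2 ^ m" .
    have "X powr (real m * a) \<le> (C * E * (n / L)) powr (real m * a)"
      using XL X a by (intro powr_mono2) auto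
    also have "\<dots> = C powr (real m * a) * E powr (real m * a) * (n / L) powr (real m * a)"
      using C E1 L by (simp add: powr_mult powr_divide)
    also have "E powr (real m * a) = real n powr \<delta>" using a m by (simp add: E_def powr_powr)
    also have "(n / L) powr (real m * a) = ((real n / L) powr a) ^ m"
      using n L by (simp add: powr_power mult.commute)
    also have "C powr (real m * a) * real n powr \<delta> * ((real n / L) powr a) ^ m
        \<le> C ^ m * real n powr \<delta> * ((real n / L) powr a) ^ m"
    proof (intro mult_right_mono)
      have "C powr (real m * a) \<le> C powr real m" using C a m by (intro powr_mono) (auto simp: mult_left_le)
      then show "C powr (real m * a) \<le> C ^ m" using C by (simp add: powr_realpow)
    qed auto
    finally show "X powr (real m * a) \<le> C ^ m * real n powr \<delta> * ((real n / L) powr a) ^ m" .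
  qed auto
  also have "\<dots> = (2 * C * (real n / L) powr a) ^ m * (real n powr \<delta> * real n powr (- \<delta>))"
    by (simp add: power_mult_distrib mult_ac)
  also have "real n powr \<delta> * real n powr (- \<delta>) = 1" using n by (simp add: powr_minus)
  finally show ?thesis by (simp add: X_def C_def L_def)
qed

lemma carath_sum_powr_uniform:
  fixes p :: real
  assumes p: "0 < p" "p < 2"
  shows "\<exists>B>0. \<forall>n>1. \<forall>m>0. \<forall>x. carath_class n x \<longrightarrow>
           (\<Sum>\<alpha>\<in>hom_idx n m. norm (x \<alpha>) powr p) \<le> (B * (real n / ln n) powr (1 - p / 2)) ^ m"
proof -
  define a where "a = 1 - p / 2"
  \<comment> \<open>This is the smaller of \<open>p / 2\<close> and \<open>1 - p / 2\<close>,
    positive exactly for \<open>0 < p < 2\<close>; the power of \<open>n\<close> lost over the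
    derivatives is then \<open>a - \<delta>\<close>.\<close>
  define \<delta> where "\<delta> = a - max 0 (1 - p)"
  have a: "0 < a" "a \<le> 1" and \<delta>: "\<delta> > 0" using p by (auto simp: a_def \<delta>_def max_def)
  \<comment> \<open>Every constant factor is absorbed into an \<open>m\<close>-th power, using
    \<open>4 \<le> 4 ^ m\<close> and \<open>24 * 4 ^ m \<le> 96 ^ m\<close>.\<close>
  define B where "B = 4 * exp a * 96 powr p * (2 * (1 + a / \<delta>))"
  have "B > 0" using a \<delta> by (simp add: B_def add_pos_pos)
  moreover have "(\<Sum>\<alpha>\<in>hom_idx n m. norm (x \<alpha>) powr p) \<le> (B * (real n / ln n) powr (1 - p / 2)) ^ m"
    if n: "n > 1" and m: "m > 0" and x: "carath_class n x" for n m x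
  proof -
    define X where "X = real (n + m) / m"
    have X: "X > 0" using m n by (simp add: X_def)
    have "(\<Sum>\<alpha>\<in>hom_idx n m. norm (x \<alpha>) powr p)
        \<le> 4 * (X ^ (m - 1) * exp m) powr a * real n powr (a - \<delta>) * (24 * 4 ^ m) powr p"
      using carath_sum_powr_le[OF x p m, folded X_def a_def] n by (simp add: \<delta>_def)
    also have "\<dots> = 4 * exp a ^ m * (24 * 4 ^ m) powr p * ((X ^ (m - 1)) powr a * real n powr (a - \<delta>))"
      using X by (simp add: powr_mult exp_powr_real exp_of_nat_mult[symmetric] mult_ac)
    also have "\<dots> \<le> 4 ^ m * exp a ^ m * (96 powr p) ^ m * (2 * (1 + a / \<delta>) * (real n / ln n) powr a) ^ m"
    proof (intro mult_mono powr_balance_le[OF a \<delta> m n, folded X_def])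
      show "(4::real) \<le> 4 ^ m" using m power_increasing[of 1 m "4::real"] by simp
      have "(24::real) * 4 ^ m \<le> 24 ^ m * 4 ^ m" using m power_increasing[of 1 m "24::real"] by simp
      also have "\<dots> = 96 ^ m" by (simp add: power_mult_distrib[symmetric])
      finally have "(24 * 4 ^ m) powr p \<le> (96 ^ m) powr p" using p by (intro powr_mono2) auto
      then show "(24 * 4 ^ m) powr p \<le> (96 powr p) ^ m"
        by (simp add: powr_realpow[symmetric] powr_powr mult.commute)
    qed auto
    finally show ?thesis by (simp add: B_def a_def power_mult_distrib mult_ac)
  qed
  ultimately show ?thesis by blast
qed

section \<open>From coefficient sums to lower bounds for \<open>H\<close>\<close>

lemma norm_monom_le:
  assumes "z \<in> polydisk n r" "\<alpha> \<in> hom_idx n m"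
  shows "norm (Defs.monom n z \<alpha>) \<le> r ^ m"
proof -
  have "norm (Defs.monom n z \<alpha>) = (\<Prod>i<n. norm (z i) ^ \<alpha> i)"
    by (simp add: Defs.monom_def prod_norm[symmetric] norm_power)
  also have "\<dots> \<le> (\<Prod>i<n. r ^ \<alpha> i)"
    using assms(1) by (intro prod_mono) (auto simp: polydisk_def less_imp_le power_mono)
  also have "\<dots> = r ^ m" using assms(2) by (simp add: hom_idx_def power_sum[symmetric])
  finally show ?thesis .
qed

text \<open>\<open>2 powr p - 1\<close> is what the Bohr inequality leaves once the constant term 1
  is taken off, and the geometric series over the degrees stays within it. So \<open>r\<close> is
  admissible for every \<open>x\<close> at once.\<close>

lemma H_ge_of_geometric_bound:
  fixes p r K \<theta> :: real
  assumes p: "p > 0" and r: "r > 0" and K: "K \<ge> 0" and \<theta>: "0 \<le> \<theta>" "\<theta> < 1"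
    and le: "K * \<theta> / (1 - \<theta>) \<le> 2 powr p - 1"
    and bound: "\<And>x m. carath_class n x \<Longrightarrow> m > 0 \<Longrightarrow>
        (\<Sum>\<alpha>\<in>hom_idx n m. norm (x \<alpha>) powr p) * (r powr p) ^ m \<le> K * \<theta> ^ m"
  shows "ereal r \<le> H p n"
  unfolding H_def
proof (rule INF_greatest)
  fix x assume "x \<in> {x. carath_class n x}"
  then have x: "carath_class n x" by simp
  have "boh_ineq p n x z" if z: "z \<in> polydisk n r" for z
  proof -
    let ?A = "multi_idx n - {\<lambda>_. 0}"
    define g where "g \<alpha> = norm (x \<alpha> * Defs.monom n z \<alpha>) powr p" for \<alpha>
    have level: "(\<Sum>\<alpha>\<in>hom_idx n m. g \<alpha>) \<le> K * \<theta> ^ m" if m: "m > 0" for m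
    proof -
      have "g \<alpha> \<le> norm (x \<alpha>) powr p * (r powr p) ^ m" if "\<alpha> \<in> hom_idx n m" for \<alpha>
      proof -
        have "norm (Defs.monom n z \<alpha>) powr p \<le> (r ^ m) powr p"
          using norm_monom_le[OF z that] p by (intro powr_mono2) auto
        also have "\<dots> = (r powr p) ^ m"
          using r by (simp add: powr_realpow[symmetric] powr_powr mult.commute)
        finally show ?thesis by (simp add: g_def norm_mult powr_mult mult_left_mono)
      qed
      then have "(\<Sum>\<alpha>\<in>hom_idx n m. g \<alpha>) \<le> (\<Sum>\<alpha>\<in>hom_idx n m. norm (x \<alpha>) powr p * (r powr p) ^ m)"
        by (rule sum_mono)
      also have "\<dots> \<le> K * \<theta> ^ m" using bound[OF x m] by (simp add: sum_distrib_right)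
      finally show ?thesis .
    qed
    \<comment> \<open>The terms are nonnegative, so a bound on finite partial sums gives both
      summability and the bound on the infinite sum.\<close>
    have fin: "sum g F \<le> 2 powr p - 1" if F: "finite F" "F \<subseteq> ?A" for F
    proof -
      define D where "D = (\<Sum>\<alpha>\<in>F. \<Sum>i<n. \<alpha> i)"
      have deg: "(\<lambda>\<alpha>. \<Sum>i<n. \<alpha> i) ` F \<subseteq> {1..D}"
      proof clarify
        fix \<alpha> assume \<alpha>: "\<alpha> \<in> F"
        then have "\<alpha> \<in> multi_idx n" "\<alpha> \<noteq> (\<lambda>_. 0)" using F by auto
        then have "\<alpha> \<notin> hom_idx n 0" by (simp add: hom_idx_0)
        then have "(\<Sum>i<n. \<alpha> i) \<noteq> 0" using \<open>\<alpha> \<in> multi_idx n\<close> by (simp add: hom_idx_def)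
        moreover have "(\<Sum>i<n. \<alpha> i) \<le> D"
          unfolding D_def using member_le_sum[of \<alpha> F "\<lambda>\<alpha>. \<Sum>i<n. \<alpha> i"] F \<alpha> by simp
        ultimately show "(\<Sum>i<n. \<alpha> i) \<in> {1..D}" unfolding atLeastAtMost_iff by linarith
      qed
      have "sum g F = (\<Sum>m\<in>{1..D}. \<Sum>\<alpha>\<in>{\<alpha> \<in> F. (\<Sum>i<n. \<alpha> i) = m}. g \<alpha>)"
        using F by (intro sum.group[symmetric] deg) auto
      also have "\<dots> \<le> (\<Sum>m\<in>{1..D}. \<Sum>\<alpha>\<in>hom_idx n m. g \<alpha>)"
        using F by (intro sum_mono sum_mono2 finite_hom_idx) (auto simp: hom_idx_def g_def)
      also have "\<dots> \<le> (\<Sum>m\<in>{1..D}. K * \<theta> ^ m)" by (intro sum_mono level) auto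
      also have "\<dots> = K * (\<Sum>m\<in>{1..D}. \<theta> ^ m)" by (simp add: sum_distrib_left)
      also have "\<dots> \<le> K * (\<theta> / (1 - \<theta>))"
      proof (intro mult_left_mono K)
        have "(\<Sum>m\<in>{1..D}. \<theta> ^ m) = \<theta> * (\<Sum>m<D. \<theta> ^ m)"
          by (simp add: sum_distrib_left sum.atLeast1_atMost_eq)
        also have "(\<Sum>m<D. \<theta> ^ m) = (1 - \<theta> ^ D) / (1 - \<theta>)"
          using \<theta> sum_gp_strict[of \<theta> D] by simp
        also have "\<theta> * \<dots> \<le> \<theta> * (1 / (1 - \<theta>))"
          using \<theta> by (intro mult_left_mono divide_right_mono) auto
        finally show "(\<Sum>m\<in>{1..D}. \<theta> ^ m) \<le> \<theta> / (1 - \<theta>)" by simp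
      qed
      finally show ?thesis using le by simp
    qed
    have sm: "g summable_on ?A"
    proof (rule nonneg_bounded_partial_sums_imp_summable_on)
      show "\<forall>\<^sub>F F in finite_subsets_at_top ?A. sum g F \<le> 2 powr p - 1"
        by (rule eventually_finite_subsets_at_top_weakI) (rule fin)
    qed (simp add: g_def)
    have "infsum g ?A \<le> 2 powr p - 1" by (rule infsum_le_finite_sums[OF sm fin])
    moreover have "infsum g ?A \<ge> 0" by (rule infsum_nonneg) (simp add: g_def)
    ultimately have "(1 + infsum g ?A) powr (1 / p) \<le> (2 powr p) powr (1 / p)"
      using p by (intro powr_mono2) auto
    then have "(1 + infsum g ?A) powr (1 / p) / 2 \<le> 1" using p by (simp add: powr_powr)
    then show ?thesis
      using sm x by (simp add: boh_ineq_def g_def[abs_def] carath_class_def)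
  qed
  then show "ereal r \<le> Hf p n x"
    unfolding Hf_def using r by (intro Sup_upper) auto
qed

lemma H_lower_bound:
  fixes p :: real
  assumes p: "0 < p" "p < 2"
  shows "\<exists>C>0. \<forall>n>1. ereal (C * (ln (real n) / real n) powr ((2 - p) / (2 * p))) \<le> H p n"
proof -
  obtain B where B: "B > 0" and bound: "\<And>n m x. n > 1 \<Longrightarrow> m > 0 \<Longrightarrow> carath_class n x \<Longrightarrow>
      (\<Sum>\<alpha>\<in>hom_idx n m. norm (x \<alpha>) powr p) \<le> (B * (real n / ln n) powr (1 - p / 2)) ^ m"
    using carath_sum_powr_uniform[OF p] by metis
  \<comment> \<open>Solves \<open>\<theta> / (1 - \<theta>) = 2 powr p - 1\<close>, the case
    \<open>K = 1\<close> of the geometric criterion.\<close>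
  define \<theta> :: real where "\<theta> = (2 powr p - 1) / 2 powr p"
  have p1: "2 powr p > 1" using p by simp
  then have \<theta>: "0 < \<theta>" "\<theta> < 1" by (auto simp: \<theta>_def)
  \<comment> \<open>Then \<open>?r powr p\<close> is \<open>\<theta> / B\<close> times a power of
    \<open>ln n / n\<close> that cancels the growth of the coefficient sums.\<close>
  define C where "C = (\<theta> / B) powr (1 / p)"
  have C: "C > 0" using B \<theta> by (simp add: C_def)
  have Cp: "C powr p = \<theta> / B" using B \<theta> p by (simp add: C_def powr_powr)
  have "ereal (C * (ln (real n) / real n) powr ((2 - p) / (2 * p))) \<le> H p n" if n: "n > 1" for n
  proof (rule H_ge_of_geometric_bound)
    let ?r = "C * (ln (real n) / real n) powr ((2 - p) / (2 * p))"
    have L: "ln (real n) > 0" using n by simp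
    show "?r > 0" using C L n by simp
    show "1 * \<theta> / (1 - \<theta>) \<le> 2 powr p - 1" using p1 by (simp add: \<theta>_def field_simps)
    have "(2 - p) / (2 * p) * p = 1 - p / 2" using p by (simp add: field_simps)
    then have rp: "?r powr p = \<theta> / B * (ln n / n) powr (1 - p / 2)"
      using L C by (simp add: powr_mult powr_powr Cp del: times_divide_eq_left times_divide_eq_right)
    fix x m assume x: "carath_class n x" and m: "m > (0::nat)"
    have "(\<Sum>\<alpha>\<in>hom_idx n m. norm (x \<alpha>) powr p) * (?r powr p) ^ m
        \<le> (B * (real n / ln n) powr (1 - p / 2)) ^ m * (?r powr p) ^ m"
      using bound[OF n m x] by (intro mult_right_mono) auto
    also have "\<dots> = (\<theta> * ((real n / ln n) powr (1 - p / 2) * (ln n / n) powr (1 - p / 2))) ^ m"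
      unfolding rp power_mult_distrib[symmetric] using B by (simp add: mult_ac)
    also have "(real n / ln n) powr (1 - p / 2) * (ln n / n) powr (1 - p / 2) = 1"
      using L n by (simp add: powr_mult[symmetric])
    finally show "(\<Sum>\<alpha>\<in>hom_idx n m. norm (x \<alpha>) powr p) * (?r powr p) ^ m \<le> 1 * \<theta> ^ m" by simp
  qed (use p \<theta> in auto)
  with C show ?thesis by blast
qed

text \<open>The l2-bound also bounds each coefficient by 2, so \<open>norm (x \<alpha>) powr p \<le>
  2 powr (p - 2) * (norm (x \<alpha>))\<^sup>2\<close> and each degree contributes at most
  \<open>2 powr p\<close>, independently of \<open>n\<close>.\<close>

lemma H_ge_of_two_le:
  fixes p :: real
  assumes p: "p \<ge> 2"
  shows "ereal (((2 powr p - 1) / (2 powr (p + 1) - 1)) powr (1 / p)) \<le> H p n"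
proof -
  \<comment> \<open>Solves \<open>2 powr p * q / (1 - q) = 2 powr p - 1\<close>.\<close>
  define q :: real where "q = (2 powr p - 1) / (2 powr (p + 1) - 1)"
  have p1: "2 powr p > 1" using p by simp
  have d: "2 powr (p + 1) = 2 * 2 powr p" by (simp add: powr_add)
  have q: "0 < q" "q < 1" using p1 by (auto simp: q_def d)
  have "ereal (q powr (1 / p)) \<le> H p n"
  proof (rule H_ge_of_geometric_bound)
    show "0 < q powr (1 / p)" using q by simp
    show "2 powr p * q / (1 - q) \<le> 2 powr p - 1" using p1 unfolding q_def d by (simp add: field_simps)
    have rp: "(q powr (1 / p)) powr p = q" using p q by (simp add: powr_powr)
    fix x m assume x: "carath_class n x" and m: "m > (0::nat)"
    have "norm (x \<alpha>) powr p \<le> 2 powr (p - 2) * (norm (x \<alpha>))\<^sup>2" if "\<alpha> \<in> hom_idx n m" for \<alpha>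
    proof -
      have "(norm (x \<alpha>))\<^sup>2 \<le> 4"
        using member_le_sum[of \<alpha> "hom_idx n m" "\<lambda>\<alpha>. (norm (x \<alpha>))\<^sup>2"] carath_l2_le[OF x m] that by auto
      then have "(norm (x \<alpha>))\<^sup>2 \<le> 2\<^sup>2" by simp
      then have "norm (x \<alpha>) \<le> 2" by (rule power2_le_imp_le) simp
      then have "norm (x \<alpha>) powr (p - 2) * norm (x \<alpha>) powr 2 \<le> 2 powr (p - 2) * norm (x \<alpha>) powr 2"
        using p by (intro mult_right_mono powr_mono2) auto
      then show ?thesis unfolding powr_add[symmetric] by simp
    qed
    then have "(\<Sum>\<alpha>\<in>hom_idx n m. norm (x \<alpha>) powr p) \<le> 2 powr (p - 2) * (\<Sum>\<alpha>\<in>hom_idx n m. (norm (x \<alpha>))\<^sup>2)"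
      by (simp add: sum_distrib_left sum_mono)
    also have "\<dots> \<le> 2 powr (p - 2) * 4" using carath_l2_le[OF x m] by (intro mult_left_mono) auto
    also have "\<dots> = 2 powr p" by (simp add: powr_diff)
    finally show "(\<Sum>\<alpha>\<in>hom_idx n m. norm (x \<alpha>) powr p) * ((q powr (1 / p)) powr p) ^ m \<le> 2 powr p * q ^ m"
      unfolding rp using q by (intro mult_right_mono) auto
  qed (use p q in auto)
  then show ?thesis by (simp only: q_def)
qed

section \<open>Upper bound from one variable\<close>

lemma boh_ineq_sum_le:
  fixes p :: real
  assumes bi: "boh_ineq p n x z" and p: "p > 0" and x0: "x (\<lambda>_. 0) = 1"
    and F: "finite F" "F \<subseteq> multi_idx n - {\<lambda>_. 0}"
  shows "(\<Sum>\<alpha>\<in>F. norm (x \<alpha> * Defs.monom n z \<alpha>) powr p) \<le> 2 powr p - 1"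
proof -
  define g where "g \<alpha> = norm (x \<alpha> * Defs.monom n z \<alpha>) powr p" for \<alpha>
  let ?I = "infsum g (multi_idx n - {\<lambda>_. 0})"
  have sm: "g summable_on (multi_idx n - {\<lambda>_. 0})" and le: "(1 + ?I) powr (1 / p) \<le> 2"
    using bi x0 by (auto simp: boh_ineq_def g_def[abs_def])
  have I0: "?I \<ge> 0" by (rule infsum_nonneg) (simp add: g_def)
  have "((1 + ?I) powr (1 / p)) powr p \<le> 2 powr p" using le p by (intro powr_mono2) auto
  then have "?I \<le> 2 powr p - 1" using p I0 by (simp add: powr_powr)
  moreover have "sum g F \<le> ?I" using F by (intro finite_sum_le_infsum sm) (auto simp: g_def)
  ultimately show ?thesis by (simp add: g_def)
qed

lemma H_le:
  assumes x: "carath_class n x" and "\<And>r. r > R \<Longrightarrow> \<exists>z\<in>polydisk n r. \<not> boh_ineq p n x z"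
  shows "H p n \<le> ereal R"
proof -
  have "Hf p n x \<le> ereal R"
    unfolding Hf_def
  proof (rule Sup_least, clarify)
    fix r assume "\<forall>z\<in>polydisk n r. boh_ineq p n x z"
    then have "\<not> r > R" using assms(2) by blast
    then show "ereal r \<le> ereal R" by simp
  qed
  then show ?thesis unfolding H_def using x by (intro INF_lower2) auto
qed

text \<open>Taylor coefficients of \<open>(1 + z 0) / (1 - z 0)\<close>, a function of the first
  variable alone.\<close>

definition cayley_coeff :: "(nat \<Rightarrow> nat) \<Rightarrow> complex" where
  "cayley_coeff \<alpha> = (if \<forall>i>0. \<alpha> i = 0 then if \<alpha> 0 = 0 then 1 else 2 else 0)"

definition first_var_idx :: "nat \<Rightarrow> nat \<Rightarrow> nat" where
  "first_var_idx k = (\<lambda>i. if i = 0 then k else 0)"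

lemma inj_first_var_idx: "inj first_var_idx"
  by (auto simp: inj_def first_var_idx_def fun_eq_iff split: if_splits)

lemma monom_first_var_idx:
  assumes "n > 0"
  shows "Defs.monom n z (first_var_idx k) = z 0 ^ k"
proof -
  have "Defs.monom n z (first_var_idx k) = (\<Prod>i<n. if i = 0 then z 0 ^ k else 1)"
    unfolding Defs.monom_def first_var_idx_def by (intro prod.cong) auto
  then show ?thesis using assms by simp
qed

text \<open>Multi-indices off the first axis contribute 0, which reduces the series to a geometric
  one; its value \<open>(1 + w) / (1 - w)\<close> has real part
  \<open>(1 - (norm w)\<^sup>2) / (norm (1 - w))\<^sup>2\<close>.\<close>

lemma carath_class_cayley:
  assumes n: "n > 0"
  shows "carath_class n cayley_coeff"
proof -
  have hs: "((\<lambda>\<alpha>. cayley_coeff \<alpha> * Defs.monom n z \<alpha>) has_sum (2 / (1 - z 0) - 1)) (multi_idx n)"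
    if z: "norm (z 0) < 1" for z
  proof -
    let ?f = "\<lambda>k. (if k = 0 then 1 else 2) * z 0 ^ k"
    have "(\<lambda>k. 2 * z 0 ^ k - (if k = 0 then 1 else 0)) sums (2 * (1 / (1 - z 0)) - 1)"
      using sums_single[of 0 "\<lambda>_. 1"] by (intro sums_diff sums_mult geometric_sums z) simp
    moreover have "(\<lambda>k. 2 * z 0 ^ k - (if k = 0 then 1 else 0)) = ?f" by (auto simp: fun_eq_iff)
    ultimately have "?f sums (2 / (1 - z 0) - 1)" by simp
    moreover have "summable (\<lambda>k. norm (?f k))"
    proof (rule summable_comparison_test')
      show "summable (\<lambda>k. 2 * norm (z 0) ^ k)" using z by (intro summable_mult summable_geometric) simp
      show "norm (norm (?f k)) \<le> 2 * norm (z 0) ^ k" if "k \<ge> 0" for k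
        by (simp add: norm_mult norm_power)
    qed
    ultimately have "(?f has_sum (2 / (1 - z 0) - 1)) UNIV" by (intro norm_summable_imp_has_sum)
    then have "((\<lambda>\<alpha>. cayley_coeff \<alpha> * Defs.monom n z \<alpha>) \<circ> first_var_idx has_sum (2 / (1 - z 0) - 1)) UNIV"
      by (simp add: o_def monom_first_var_idx[OF n]) (simp add: cayley_coeff_def first_var_idx_def)
    then have *: "((\<lambda>\<alpha>. cayley_coeff \<alpha> * Defs.monom n z \<alpha>) has_sum (2 / (1 - z 0) - 1)) (range first_var_idx)"
      by (subst has_sum_reindex[OF inj_first_var_idx])
    show ?thesis
    proof (rule has_sum_cong_neutral[THEN iffD1, OF _ _ _ *])
      fix \<alpha> assume "\<alpha> \<in> multi_idx n - range first_var_idx"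
      then have "\<alpha> \<noteq> first_var_idx (\<alpha> 0)" by auto
      moreover have "\<alpha> = first_var_idx (\<alpha> 0)" if "\<forall>i>0. \<alpha> i = 0"
        using that by (auto simp: first_var_idx_def)
      ultimately have "\<not> (\<forall>i>0. \<alpha> i = 0)" by blast
      then show "cayley_coeff \<alpha> * Defs.monom n z \<alpha> = 0" by (auto simp: cayley_coeff_def)
    next
      fix \<alpha> assume "\<alpha> \<in> range first_var_idx - multi_idx n"
      then show "cayley_coeff \<alpha> * Defs.monom n z \<alpha> = 0"
        using n by (auto simp: multi_idx_def first_var_idx_def)
    qed auto
  qed
  have "Re (2 / (1 - w) - 1) > 0" if w: "norm w < 1" for w :: complex
  proof -
    have "w \<noteq> 1" using w by auto
    then have "2 / (1 - w) - 1 = (1 + w) / (1 - w)" by (simp add: field_simps)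
    also have "Re \<dots> = Re ((1 + w) * cnj (1 - w)) / (norm (1 - w))\<^sup>2"
      by (simp add: complex_div_cnj[of "1 + w"] Re_divide_of_real flip: of_real_power)
    also have "Re ((1 + w) * cnj (1 - w)) = 1 - (norm w)\<^sup>2"
      unfolding cmod_power2 by (simp add: algebra_simps power2_eq_square)
    also have "(1 - (norm w)\<^sup>2) / (norm (1 - w))\<^sup>2 > 0"
      using w \<open>w \<noteq> 1\<close> by (intro divide_pos_pos) (auto simp: power_less_one_iff abs_square_less_1)
    finally show ?thesis .
  qed
  then show ?thesis
    using hs n by (auto simp: carath_class_def polydisk_def pser_def has_sum_iff cayley_coeff_def)
qed

lemma H_le_of_one_variable:
  fixes p :: real
  assumes p: "p > 0" and n: "n > 0"
  shows "H p n \<le> ereal (((2 powr p - 1) / (2 powr (p + 1) - 1)) powr (1 / p))"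
proof (rule H_le[OF carath_class_cayley[OF n]])
  define q :: real where "q = (2 powr p - 1) / (2 powr (p + 1) - 1)"
  have p1: "2 powr p > 1" using p by simp
  have d: "2 powr (p + 1) = 2 * 2 powr p" by (simp add: powr_add)
  have q: "0 < q" "q < 1" using p1 by (auto simp: q_def d)
  fix r assume "((2 powr p - 1) / (2 powr (p + 1) - 1)) powr (1 / p) < r"
  then have r: "q powr (1 / p) < r" by (simp add: q_def)
  have "q powr (1 / p) < 1" using q p powr_less_mono2[of "1 / p" q 1] by simp
  \<comment> \<open>A radius strictly between the claimed bound and \<open>r\<close>, kept below 1
    so that the geometric series in \<open>y = s powr p\<close> converges.\<close>
  then obtain s where s: "q powr (1 / p) < s" "s < r" "s < 1" using r dense[of _ "min r 1"] by auto
  have s0: "s > 0" using s(1) q by (metis less_trans powr_gt_zero less_irrefl)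
  define y where "y = s powr p"
  have "(q powr (1 / p)) powr p < s powr p" using s p by (intro powr_less_mono2) auto
  then have y: "q < y" using p q by (simp add: y_def powr_powr)
  have y1: "y < 1" using s s0 p powr_less_mono2[of p s 1] by (simp add: y_def)
  define z where "z i = (if i = 0 then complex_of_real s else 0)" for i :: nat
  have "z \<in> polydisk n r" using s s0 by (auto simp: polydisk_def z_def)
  moreover have "\<not> boh_ineq p n cayley_coeff z"
  proof
    assume bi: "boh_ineq p n cayley_coeff z"
    \<comment> \<open>Letting \<open>K\<close> grow turns these bounds into
      \<open>2 powr p * y / (1 - y) \<le> 2 powr p - 1\<close>, that is \<open>y \<le> q\<close>,
      against the choice of \<open>s\<close>.\<close>
    have partial: "(\<Sum>k<K. 2 powr p * y * y ^ k) \<le> 2 powr p - 1" for K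
    proof -
      have "(\<Sum>\<alpha>\<in>first_var_idx ` {1..K}. norm (cayley_coeff \<alpha> * Defs.monom n z \<alpha>) powr p) \<le> 2 powr p - 1"
      proof (rule boh_ineq_sum_le[OF bi p])
        show "first_var_idx ` {1..K} \<subseteq> multi_idx n - {\<lambda>_. 0}"
          using n by (auto simp: multi_idx_def first_var_idx_def dest: fun_cong[of _ _ 0])
      qed (auto simp: cayley_coeff_def)
      also have "(\<Sum>\<alpha>\<in>first_var_idx ` {1..K}. norm (cayley_coeff \<alpha> * Defs.monom n z \<alpha>) powr p)
          = (\<Sum>k\<in>{1..K}. norm (cayley_coeff (first_var_idx k) * z 0 ^ k) powr p)"
        by (subst sum.reindex) (auto intro: inj_on_subset[OF inj_first_var_idx] simp: monom_first_var_idx[OF n])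
      also have "\<dots> = (\<Sum>k\<in>{1..K}. 2 powr p * y ^ k)"
      proof (intro sum.cong refl)
        fix k assume "k \<in> {1..K}"
        then have "norm (cayley_coeff (first_var_idx k) * z 0 ^ k) = 2 * s powr k"
          using s0 by (simp add: cayley_coeff_def first_var_idx_def z_def norm_mult norm_power powr_realpow)
        then show "norm (cayley_coeff (first_var_idx k) * z 0 ^ k) powr p = 2 powr p * y ^ k"
          using s0 by (simp add: powr_mult powr_powr y_def powr_power mult.commute)
      qed
      also have "\<dots> = (\<Sum>k<K. 2 powr p * y * y ^ k)"
        by (simp add: sum.atLeast1_atMost_eq mult_ac)
      finally show ?thesis .
    qed
    have y0: "y > 0" using y q by simp
    have "(\<lambda>k. 2 powr p * y * y ^ k) sums (2 powr p * y * (1 / (1 - y)))"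
      using y0 y1 by (intro sums_mult geometric_sums) simp
    then have "2 powr p * y * (1 / (1 - y)) \<le> 2 powr p - 1"
      using suminf_le_const[of "\<lambda>k. 2 powr p * y * y ^ k" "2 powr p - 1"] partial by (simp add: sums_iff)
    then have "y * (2 * 2 powr p - 1) \<le> 2 powr p - 1" using y1 by (simp add: field_simps)
    then have "y \<le> q" using p1 unfolding q_def d by (simp add: field_simps)
    then show False using y by simp
  qed
  ultimately show "\<exists>z\<in>polydisk n r. \<not> boh_ineq p n cayley_coeff z" by blast
qed

section \<open>Upper bound from Fourier matrices\<close>

text \<open>The one-variable case of Parseval on the grid: the Fourier matrix is
  \<open>sqrt q\<close> times a unitary one.\<close>

lemma dft_parseval:
  assumes "q > 0"
  shows "(\<Sum>b<q. (norm (\<Sum>a<q. v a * root_unity q (int b * int a)))\<^sup>2) = q * (\<Sum>a<q. (norm (v a))\<^sup>2)"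
  using grid_parseval[of "grid (Suc 0) q" "Suc 0" q "\<lambda>\<alpha>. v (\<alpha> 0)"] assms
  by (simp add: sum_idx_box_Suc idx_box_0 Defs.monom_def grid_pt_def root_unity_power)

text \<open>
  With \<open>\<omega> = exp (2 \<pi> i / q)\<close>, the form \<open>chain_form q y m 0\<close> is the sum over \<open>i\<^sub>0, \<dots>, i\<^bsub>m-1\<^esub> < q\<close> of
  \<open>\<omega>\<^bsup>i\<^sub>0 i\<^sub>1 + \<dots> + i\<^bsub>m-2\<^esub> i\<^bsub>m-1\<^esub>\<^esup> y\<^sub>0(i\<^sub>0) \<dots> y\<^bsub>m-1\<^esub>(i\<^bsub>m-1\<^esub>)\<close>. Each step of the recursion applies
  a diagonal contraction followed by the discrete Fourier matrix, whose operator norm is \<open>sqrt q\<close>;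
  this replaces the random polynomials usually taken here.
\<close>
context
  fixes q :: nat
begin

fun chain_form :: "(nat \<Rightarrow> nat \<Rightarrow> complex) \<Rightarrow> nat \<Rightarrow> nat \<Rightarrow> complex" where
  "chain_form y 0 b = 1"
| "chain_form y (Suc m) b = (\<Sum>a<q. y m a * chain_form y m a * root_unity q (int b * int a))"

text \<open>\<open>b\<close> stands for the label following the last index; at \<open>b = 0\<close>
  the final character is 1, which leaves the coefficients of the form used later.\<close>

fun chain_coeff :: "nat \<Rightarrow> (nat \<Rightarrow> nat) \<Rightarrow> nat \<Rightarrow> complex" where
  "chain_coeff 0 i b = 1"
| "chain_coeff (Suc m) i b = chain_coeff m i (i m) * root_unity q (int b * int (i m))"

lemma chain_coeff_cong: "(\<And>j. j < m \<Longrightarrow> i j = i' j) \<Longrightarrow> chain_coeff m i b = chain_coeff m i' b"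
  by (induction m arbitrary: b) auto

lemma norm_chain_coeff [simp]: "norm (chain_coeff m i b) = 1"
  by (induction m arbitrary: b) (auto simp: norm_mult)

lemma chain_form_expand:
  "chain_form y m b = (\<Sum>i\<in>grid m q. chain_coeff m i b * (\<Prod>j<m. y j (i j)))"
proof (induction m arbitrary: b)
  case (Suc m)
  have upd: "chain_coeff m (i(m := a)) c = chain_coeff m i c" for i a c
    by (rule chain_coeff_cong) simp
  have "(\<Sum>i\<in>grid (Suc m) q. chain_coeff (Suc m) i b * (\<Prod>j<Suc m. y j (i j)))
      = (\<Sum>i\<in>grid m q. \<Sum>a<q. y m a * (chain_coeff m i a * (\<Prod>j<m. y j (i j))) * root_unity q (int b * int a))"
    by (simp add: sum_idx_box_Suc upd mult_ac)
  also have "\<dots> = chain_form y (Suc m) b"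
    by (subst sum.swap) (simp add: Suc sum_distrib_left sum_distrib_right)
  finally show ?case by simp
qed (simp add: idx_box_0)

text \<open>The induction needs the whole vector over \<open>b\<close>: it starts from the all-ones
  vector with squared norm \<open>q\<close>, and each step multiplies the squared norm by at most
  \<open>q\<close>.\<close>

lemma chain_form_le:
  assumes q: "q > 0" and y: "\<And>j a. j < m \<Longrightarrow> a < q \<Longrightarrow> norm (y j a) \<le> 1"
  shows "(\<Sum>b<q. (norm (chain_form y m b))\<^sup>2) \<le> real q ^ Suc m"
  using y
proof (induction m)
  case (Suc m)
  have "(\<Sum>b<q. (norm (chain_form y (Suc m) b))\<^sup>2) = q * (\<Sum>a<q. (norm (y m a * chain_form y m a))\<^sup>2)"
    by (simp add: dft_parseval[OF q])
  also have "\<dots> \<le> q * (\<Sum>a<q. (norm (chain_form y m a))\<^sup>2)"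
    using Suc.prems[of m]
    by (intro mult_left_mono sum_mono power_mono) (auto simp: norm_mult intro!: mult_left_le_one_le)
  also have "\<dots> \<le> real q * real q ^ Suc m" using Suc by (intro mult_left_mono) auto
  finally show ?case by simp
qed simp

text \<open>The variable of block \<open>j < m\<close> with label \<open>a < q\<close> sits at position \<open>j * q + a\<close>.\<close>
definition block_idx :: "nat \<Rightarrow> (nat \<Rightarrow> nat) \<Rightarrow> nat \<Rightarrow> nat" where
  "block_idx m i v = (if v < m * q \<and> v mod q = i (v div q) then 1 else 0)"

lemma block_idx_at:
  assumes "j < m" "a < q"
  shows "block_idx m i (j * q + a) = (if a = i j then 1 else 0)"
proof -
  have "j * q + a < Suc j * q" using assms by simp
  also have "\<dots> \<le> m * q" using assms by (intro mult_right_mono) auto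
  finally show ?thesis using assms by (simp add: block_idx_def)
qed

lemma inj_on_block_idx: "inj_on (block_idx m) (grid m q)"
proof (rule inj_onI)
  fix i i' assume i: "i \<in> grid m q" "i' \<in> grid m q" and eq: "block_idx m i = block_idx m i'"
  show "i = i'"
  proof
    fix j
    show "i j = i' j"
    proof (cases "j < m")
      case True
      then have "i j < q" using i by (simp add: idx_box_def)
      then show ?thesis
        using fun_cong[OF eq, of "j * q + i j"] True by (simp add: block_idx_at split: if_splits)
    next
      case False
      then show ?thesis using i by (simp add: idx_box_def multi_idx_def)
    qed
  qed
qed

lemma monom_block_idx:
  assumes i: "i \<in> grid m q" and n: "m * q \<le> n"
  shows "Defs.monom n z (block_idx m i) = (\<Prod>j<m. z (j * q + i j))"
proof -
  let ?V = "{v. v < m * q \<and> v mod q = i (v div q)}"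
  have iq: "i j < q" if "j < m" for j using i that by (simp add: idx_box_def)
  have "Defs.monom n z (block_idx m i) = (\<Prod>v<n. if v \<in> ?V then z v else 1)"
    unfolding Defs.monom_def by (intro prod.cong) (auto simp: block_idx_def)
  also have "\<dots> = (\<Prod>v\<in>?V. z v)"
    using n by (intro prod.mono_neutral_cong_right) auto
  also have "?V = (\<lambda>j. j * q + i j) ` {..<m}"
  proof (intro equalityI subsetI)
    fix v assume v: "v \<in> ?V"
    then have "v div q < m" by (simp add: less_mult_imp_div_less)
    moreover have "v = (v div q) * q + i (v div q)" using v by (metis (mono_tags) div_mult_mod_eq mem_Collect_eq)
    ultimately show "v \<in> (\<lambda>j. j * q + i j) ` {..<m}" by blast
  next
    fix v assume "v \<in> (\<lambda>j. j * q + i j) ` {..<m}"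
    then obtain j where j: "j < m" "v = j * q + i j" by auto
    then have "block_idx m i v = 1" using block_idx_at[OF j(1) iq[OF j(1)]] by simp
    then show "v \<in> ?V" by (simp add: block_idx_def split: if_splits)
  qed
  also have "(\<Prod>v\<in>(\<lambda>j. j * q + i j) ` {..<m}. z v) = (\<Prod>j<m. z (j * q + i j))"
  proof (subst prod.reindex)
    show "inj_on (\<lambda>j. j * q + i j) {..<m}"
    proof (rule inj_onI)
      fix j k assume "j \<in> {..<m}" "k \<in> {..<m}" and eq: "j * q + i j = k * q + i k"
      then have "i j < q" "i k < q" using iq by auto
      then show "j = k" using arg_cong[OF eq, of "\<lambda>v. v div q"] by simp
    qed
  qed simp
  finally show ?thesis .
qed

lemma block_idx_nonzero:
  assumes "m > 0" "i \<in> grid m q"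
  shows "block_idx m i \<noteq> (\<lambda>_. 0)"
proof
  assume "block_idx m i = (\<lambda>_. 0)"
  moreover have "i 0 < q" using assms by (simp add: idx_box_def)
  ultimately show False using block_idx_at[of 0 m "i 0" i] assms by simp
qed

text \<open>Coefficients of \<open>1 + F / (2 * K)\<close>, where \<open>F\<close> is the chain form
  at \<open>b = 0\<close> and \<open>K = sqrt (real q ^ Suc m)\<close> bounds it on the polydisk, so
  that the perturbation has modulus at most 1/2.\<close>

definition chain_series :: "nat \<Rightarrow> (nat \<Rightarrow> nat) \<Rightarrow> complex" where
  "chain_series m \<alpha> =
    (if \<alpha> = (\<lambda>_. 0) then 1
     else if \<alpha> \<in> block_idx m ` grid m q
       then chain_coeff m (inv_into (grid m q) (block_idx m) \<alpha>) 0 / of_real (2 * sqrt (real q ^ Suc m))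
     else 0)"

lemma chain_series_block_idx:
  assumes "m > 0" "i \<in> grid m q"
  shows "chain_series m (block_idx m i) = chain_coeff m i 0 / of_real (2 * sqrt (real q ^ Suc m))"
  using assms by (simp add: chain_series_def block_idx_nonzero inv_into_f_f[OF inj_on_block_idx])

lemma block_idx_multi_idx: "m * q \<le> n \<Longrightarrow> block_idx m i \<in> multi_idx n"
  by (auto simp: multi_idx_def block_idx_def)

lemma carath_class_chain_series:
  assumes m: "m > 0" and q: "q > 0" and n: "m * q \<le> n"
  shows "carath_class n (chain_series m)"
proof -
  define K where "K = sqrt (real q ^ Suc m)"
  have K: "K > 0" using q by (simp add: K_def)
  have "(\<lambda>\<alpha>. chain_series m \<alpha> * Defs.monom n z \<alpha>) summable_on multi_idx n \<and> Re (pser n (chain_series m) z) > 0"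
    if z: "z \<in> polydisk n 1" for z
  proof -
    let ?f = "\<lambda>\<alpha>. chain_series m \<alpha> * Defs.monom n z \<alpha>"
    let ?B = "block_idx m ` grid m q"
    define y where "y j a = z (j * q + a)" for j a
    have "sum ?f ?B = (\<Sum>i\<in>grid m q. ?f (block_idx m i))"
      by (rule sum.reindex_cong[OF inj_on_block_idx]) auto
    also have "\<dots> = (\<Sum>i\<in>grid m q. chain_coeff m i 0 / of_real (2 * K) * (\<Prod>j<m. y j (i j)))"
      by (intro sum.cong refl) (simp add: chain_series_block_idx[OF m] monom_block_idx[OF _ n] y_def K_def)
    also have "\<dots> = chain_form y m 0 / of_real (2 * K)"
      by (simp add: chain_form_expand sum_divide_distrib)
    finally have B: "sum ?f ?B = chain_form y m 0 / of_real (2 * K)" .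
    have "sum ?f (insert (\<lambda>_. 0) ?B) = ?f (\<lambda>_. 0) + sum ?f ?B"
      using block_idx_nonzero[OF m] by (intro sum.insert) (auto simp: eq_commute[of "\<lambda>_. 0"])
    also have "?f (\<lambda>_. 0) = 1" by (simp add: chain_series_def Defs.monom_def)
    finally have eq: "sum ?f (insert (\<lambda>_. 0) ?B) = 1 + chain_form y m 0 / of_real (2 * K)" by (simp only: B)
    have "(?f has_sum sum ?f (insert (\<lambda>_. 0) ?B)) (insert (\<lambda>_. 0) ?B)" by (intro has_sum_finite) simp
    then have hs: "(?f has_sum sum ?f (insert (\<lambda>_. 0) ?B)) (multi_idx n)"
      by (rule has_sum_cong_neutral[THEN iffD1, rotated -1])
         (use n in \<open>auto simp: chain_series_def multi_idx_def block_idx_def\<close>)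
    have "norm (y j a) \<le> 1" if "j < m" "a < q" for j a
    proof -
      have "j * q + a < Suc j * q" using that by simp
      also have "\<dots> \<le> m * q" using that by (intro mult_right_mono) auto
      finally show ?thesis using z n by (auto simp: polydisk_def y_def intro: less_imp_le)
    qed
    then have "(\<Sum>b<q. (norm (chain_form y m b))\<^sup>2) \<le> real q ^ Suc m"
      using chain_form_le[OF q] by simp
    \<comment> \<open>Bounding one entry by the norm of the whole vector costs \<open>sqrt q\<close>
      against the root mean square; in the radius this becomes the factor
      \<open>real q powr (1 / (2 * m))\<close>.\<close>
    then have "(norm (chain_form y m 0))\<^sup>2 \<le> real q ^ Suc m"
      using member_le_sum[of 0 "{..<q}" "\<lambda>b. (norm (chain_form y m b))\<^sup>2"] q by simp
    then have "norm (chain_form y m 0) \<le> K" unfolding K_def by (rule real_le_rsqrt)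
    then have "norm (chain_form y m 0 / of_real (2 * K)) \<le> 1 / 2"
      using K by (simp add: norm_divide field_simps)
    then have "Re (chain_form y m 0 / of_real (2 * K)) \<ge> - (1 / 2)"
      using abs_Re_le_cmod[of "chain_form y m 0 / of_real (2 * K)"] by linarith
    then have "Re (1 + chain_form y m 0 / of_real (2 * K)) > 0"
      unfolding plus_complex.sel one_complex.sel by linarith
    then show ?thesis using hs eq by (auto simp: pser_def has_sum_iff)
  qed
  then show ?thesis by (simp add: carath_class_def chain_series_def)
qed

text \<open>At the point with all coordinates \<open>s\<close>, the coefficients of equal modulus
  give \<open>q ^ m\<close> equal terms; a sum below \<open>2 powr p\<close> forces
  \<open>real q powr (m / p) * s ^ m < 4 * K\<close>.\<close>

lemma H_le_chain_series:
  fixes p :: real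
  assumes p: "p > 0" and m: "m > 0" and q: "q > 0" and n: "m * q \<le> n"
  shows "H p n \<le> ereal (4 * real q powr (1 / (2 * real m)) * real q powr (1 / 2 - 1 / p))"
proof (rule H_le[OF carath_class_chain_series[OF m q n]])
  \<comment> \<open>Chosen so that \<open>real q powr (m / p) * R ^ m = 4 ^ m * K\<close>, which is
    at least \<open>4 * K\<close>.\<close>
  define R :: real where "R = 4 * real q powr (1 / (2 * real m)) * real q powr (1 / 2 - 1 / p)"
  have R: "R > 0" using q by (simp add: R_def)
  define K where "K = sqrt (real q ^ Suc m)"
  have K: "K > 0" using q by (simp add: K_def)
  fix r :: real assume "4 * real q powr (1 / (2 * real m)) * real q powr (1 / 2 - 1 / p) < r"
  then obtain s where s: "R < s" "s < r" using dense[of R r] by (auto simp: R_def)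
  have s0: "s > 0" using R s by simp
  define z where "z i = complex_of_real s" for i :: nat
  have "z \<in> polydisk n r" using s s0 by (simp add: polydisk_def z_def)
  moreover have "\<not> boh_ineq p n (chain_series m) z"
  proof
    assume bi: "boh_ineq p n (chain_series m) z"
    have "(\<Sum>\<alpha>\<in>block_idx m ` grid m q. norm (chain_series m \<alpha> * Defs.monom n z \<alpha>) powr p) \<le> 2 powr p - 1"
      by (rule boh_ineq_sum_le[OF bi p])
         (use block_idx_multi_idx[OF n] block_idx_nonzero[OF m] in \<open>auto simp: chain_series_def\<close>)
    also have "(\<Sum>\<alpha>\<in>block_idx m ` grid m q. norm (chain_series m \<alpha> * Defs.monom n z \<alpha>) powr p)
        = (\<Sum>i\<in>grid m q. (s ^ m / (2 * K)) powr p)"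
    proof (rule sum.reindex_cong[OF inj_on_block_idx refl])
      fix i assume i: "i \<in> grid m q"
      show "norm (chain_series m (block_idx m i) * Defs.monom n z (block_idx m i)) powr p = (s ^ m / (2 * K)) powr p"
        using s0 K by (simp add: chain_series_block_idx[OF m i] monom_block_idx[OF i n] z_def
            norm_mult norm_divide norm_power K_def)
    qed
    also have "\<dots> = real q ^ m * (s ^ m / (2 * K)) powr p" by simp
    finally have "real q ^ m * (s ^ m / (2 * K)) powr p < 2 powr p" by simp
    then have "(real q ^ m * (s ^ m / (2 * K)) powr p) powr (1 / p) < (2 powr p) powr (1 / p)"
      using p by (intro powr_less_mono2) auto
    then have "real q powr (m / p) * (s ^ m / (2 * K)) < 2"
      using p q s0 K by (simp add: powr_mult powr_powr powr_realpow[symmetric])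
    then have lt: "real q powr (m / p) * s ^ m < 4 * K" using K by (simp add: field_simps)
    have "m * (1 / (2 * m) + (1 / 2 - 1 / p)) = 1 / 2 + m / 2 + - (m / p)"
      using m p by (simp add: field_simps)
    then have "R ^ m = 4 ^ m * (q powr (1 / 2) * q powr (m / 2) * q powr (- (m / p)))"
      unfolding R_def mult.assoc powr_add[symmetric] power_mult_distrib using q
      by (simp add: powr_power)
    also have "q powr (1 / 2) * q powr (m / 2) = K"
    proof -
      have "K = (real q powr Suc m) powr (1 / 2)"
        using q by (simp add: K_def powr_half_sqrt powr_realpow[of "real q" "Suc m"] del: power_Suc of_nat_Suc)
      then show ?thesis using q by (simp add: powr_powr powr_add[symmetric] field_simps)
    qed
    finally have "real q powr (m / p) * R ^ m = 4 ^ m * K * (real q powr (m / p) * real q powr (- (m / p)))"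
      by simp
    also have "real q powr (m / p) * real q powr (- (m / p)) = 1" using q by (simp add: powr_minus)
    finally have "real q powr (m / p) * R ^ m = 4 ^ m * K" by simp
    moreover have "4 * K \<le> 4 ^ m * K" using K m power_increasing[of 1 m "4::real"] by simp
    moreover have "real q powr (m / p) * R ^ m \<le> real q powr (m / p) * s ^ m"
      using s R by (intro mult_left_mono power_mono) auto
    ultimately show False using lt by linarith
  qed
  ultimately show "\<exists>z\<in>polydisk n r. \<not> boh_ineq p n (chain_series m) z" by blast
qed

end

lemma H_upper_bound:
  fixes p :: real
  assumes p: "0 < p" "p < 2"
  shows "\<exists>D>0. \<forall>n>1. H p n \<le> ereal (D * (ln (real n) / real n) powr ((2 - p) / (2 * p)))"
proof -
  define a where "a = (2 - p) / (2 * p)"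
  have a: "a > 0" using p by (simp add: a_def)
  have a': "1 / 2 - 1 / p = - a" using p by (simp add: a_def field_simps)
  have "H p n \<le> ereal (12 * 6 powr a * (ln (real n) / real n) powr a)" if n: "n > 1" for n
  proof -
    define L where "L = ln (real n)"
    have "ln 2 \<le> L" using n by (simp add: L_def)
    then have L: "L \<ge> 2 / 3" using ln2_ge_two_thirds by linarith
    \<comment> \<open>Since \<open>m\<close> is at least \<open>ln n\<close>, the factor
      \<open>real n powr (1 / (2 * m))\<close> stays bounded; since it is not much larger,
      \<open>q\<close> keeps the order \<open>n / ln n\<close>.\<close>
    define m where "m = nat \<lceil>L\<rceil>"
    have m: "m > 0" and Lm: "L \<le> m" and mL: "m < L + 1" using L by (simp_all add: m_def) linarith+
    have "L \<le> real n - 1" using n ln_le_minus_one[of "real n"] by (simp add: L_def)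
    then have "m < Suc n" using mL by linarith
    then have mn: "m \<le> n" by simp
    define q where "q = n div m"
    have q: "q > 0" using m mn by (simp add: q_def div_greater_zero_iff)
    have mq: "m * q \<le> n" by (simp add: q_def)
    \<comment> \<open>Rounding down in \<open>q\<close> costs at most a factor 2 because
      \<open>q \<ge> 1\<close>, and rounding up in \<open>m\<close> at most a factor 3 because
      \<open>1 \<le> 2 * L\<close>; hence the 6.\<close>
    have "n < m * (q + 1)" using m by (simp add: q_def dividend_less_times_div)
    also have "\<dots> \<le> m * (2 * q)" using q by (intro mult_left_mono) auto
    finally have "real n < real (m * (2 * q))" by (simp only: of_nat_less_iff)
    also have "\<dots> = real m * (2 * real q)" by simp
    also have "\<dots> \<le> (3 * L) * (2 * real q)" using mL L by (intro mult_right_mono) auto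
    finally have nq: "n / (6 * L) \<le> q" using L by (simp add: field_simps)
    have "real q powr (1 / (2 * real m)) \<le> real n powr (1 / (2 * real m))"
      using mq m q by (intro powr_mono2) (auto simp: q_def intro: div_le_dividend)
    also have "\<dots> = exp (L / (2 * real m))" using n by (simp add: powr_def L_def)
    also have "\<dots> \<le> exp 1" using Lm m by (simp add: field_simps)
    also have "\<dots> \<le> 3" by (rule exp_le)
    finally have 1: "real q powr (1 / (2 * real m)) \<le> 3" .
    have "q powr (- a) \<le> (n / (6 * L)) powr (- a)" using nq n L a by (intro powr_mono2') auto
    also have "\<dots> = 6 powr a * (L / n) powr a"
      using n L by (simp add: powr_minus powr_divide powr_mult field_simps)
    finally have 2: "q powr (- a) \<le> 6 powr a * (L / n) powr a" .
    have "4 * real q powr (1 / (2 * real m)) * real q powr (- a) \<le> 4 * 3 * (6 powr a * (L / n) powr a)"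
      using 1 2 by (intro mult_mono) auto
    then show ?thesis
      using H_le_chain_series[OF p(1) m q mq] unfolding a' L_def
      by (elim order_trans) (simp add: mult_ac)
  qed
  then show ?thesis unfolding a_def by (intro exI[of _ "12 * 6 powr ((2 - p) / (2 * p))"]) auto
qed

theorem theorem1p5:
  shows "(\<forall>n::nat. \<forall>p::real. n > 1 \<and> p \<ge> 2 \<longrightarrow>
            H p n = ereal (((2 powr p - 1) / (2 powr (p + 1) - 1)) powr (1 / p)))
       \<and> (\<forall>p::real. 0 < p \<and> p < 2 \<longrightarrow>
            (\<exists>C D. C > 0 \<and> D > 0 \<and>
              (\<forall>n::nat. n > 1 \<longrightarrow>
                 ereal (C * (ln (real n) / real n) powr ((2 - p) / (2 * p))) \<le> H p n \<and>
                 H p n \<le> ereal (D * (ln (real n) / real n) powr ((2 - p) / (2 * p))))))"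
proof (intro conjI allI impI)
  fix n :: nat and p :: real assume "n > 1 \<and> p \<ge> 2"
  then show "H p n = ereal (((2 powr p - 1) / (2 powr (p + 1) - 1)) powr (1 / p))"
    by (intro antisym H_le_of_one_variable H_ge_of_two_le) auto
next
  fix p :: real assume "0 < p \<and> p < 2"
  then show "\<exists>C D. C > 0 \<and> D > 0 \<and>
      (\<forall>n::nat. n > 1 \<longrightarrow>
         ereal (C * (ln (real n) / real n) powr ((2 - p) / (2 * p))) \<le> H p n \<and>
         H p n \<le> ereal (D * (ln (real n) / real n) powr ((2 - p) / (2 * p))))"
    using H_lower_bound[of p] H_upper_bound[of p] by metis
qed

end
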